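(* Let, for some $\lambda_0>0$ and $\varepsilon_0>0$, the representation $$F(\lambda)=\bigcup_{n=1}^N F_n(\lambda),\qquad F_n(\lambda)\cap F_m(\lambda)=\emptyset\ \text{ for } n\ne m,$$ hold for $\lambda=\lambda_0+\varepsilon_0$. Suppose that for all $n=1,\dots,N$ there exist points $x_n\in F_n(\lambda_0)$ such that the estimates $$\langle x-x_n,\nabla v(x)\rangle\le c_0\,v(x),\qquad x\in F_n(\lambda_0),$$ are satisfied with some constant $c_0>0$. Then $$U(\psi_\hbar)=\int_{\mathbb{R}^d}v(x)\psi_\hbar^2(x)\,dx\ge c\,\lambda_\hbar$$ for all $\lambda_\hbar\in(\lambda_0-\varepsilon_0/2,\lambda_0+\varepsilon_0/2)$, an arbitrary $c<2(c_0+2)^{-1}$ and sufficiently small $\hbar$.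
   Context: $H_\hbar=-\hbar^2\Delta+v(x)$, $\hbar>0$, is the Schrödinger operator in $L_2(\mathbb{R}^d)$, where $v\in C^\infty(\mathbb{R}^d)$ is real-valued, $\min_{x\in\mathbb{R}^d}v(x)=0$ and $v_\infty:=\liminf_{|x|\to\infty}v(x)>0$. The energy $\lambda_0$ lies in $(0,v_\infty)$ and is non-critical, that is, $\nabla v(x)\ne0$ for all $x$ with $v(x)=\lambda_0$. $\psi_\hbar$ is a real eigenfunction of $H_\hbar$ with eigenvalue $\lambda_\hbar$: $-\hbar^2\Delta\psi_\hbar+v\psi_\hbar=\lambda_\hbar\psi_\hbar$, $\psi_\hbar\in L_2(\mathbb{R}^d)$, normalized by $\int_{\mathbb{R}^d}\psi_\hbar^2dx=1$. For $\lambda\in\mathbb{R}$, $F(\lambda)=\{x\in\mathbb{R}^d:v(x)<\lambda\}$. The sets $F_n(\lambda)$ are the potential wells for the energy $\lambda$; $F_n(\lambda_0)$ is the part of $F(\lambda_0)$ lying in $F_n(\lambda_0+\varepsilon_0)$. $\langle\cdot,\cdot\rangle$ is the Euclidean scalar product.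
   Formalization: The bound is proved for λ_ħ in the stated window with also λ_ħ<λ_0+ε, where ε>0 depends on c: the full upper half fails since the estimate is assumed only where v<λ_0. Wells F_n are taken open, ψ_ħ as a C² solution. *)

theory Defs
  imports "HOL-Analysis.Analysis"
begin

definition partial_deriv :: "'a::euclidean_space \<Rightarrow> ('a \<Rightarrow> real) \<Rightarrow> 'a \<Rightarrow> real" where
  "partial_deriv b f x = frechet_derivative f (at x) b"

definition grad :: "('a::euclidean_space \<Rightarrow> real) \<Rightarrow> 'a \<Rightarrow> 'a" where
  "grad f x = (\<Sum>b\<in>Basis. partial_deriv b f x *\<^sub>R b)"

definition laplacian :: "('a::euclidean_space \<Rightarrow> real) \<Rightarrow> 'a \<Rightarrow> real" where
  "laplacian f x = (\<Sum>b\<in>Basis. partial_deriv b (partial_deriv b f) x)"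

fun C_k :: "nat \<Rightarrow> ('a::euclidean_space \<Rightarrow> real) \<Rightarrow> bool" where
  "C_k 0 f \<longleftrightarrow> continuous_on UNIV f"
| "C_k (Suc k) f \<longleftrightarrow> f differentiable_on UNIV \<and> (\<forall>b\<in>Basis. C_k k (partial_deriv b f))"

definition C_infinity :: "('a::euclidean_space \<Rightarrow> real) \<Rightarrow> bool" where
  "C_infinity f \<longleftrightarrow> (\<forall>k. C_k k f)"

text \<open>The value is an extended real, so that confining potentials (value \<open>\<infinity>\<close>) are included.\<close>

definition v_infty :: "('a::euclidean_space \<Rightarrow> real) \<Rightarrow> ereal" where
  "v_infty v = Liminf at_infinity (\<lambda>x. ereal (v x))"

definition sublevel :: "('a \<Rightarrow> real) \<Rightarrow> real \<Rightarrow> 'a set" where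
  "sublevel v E = {x. v x < E}"

definition noncritical :: "('a::euclidean_space \<Rightarrow> real) \<Rightarrow> real \<Rightarrow> bool" where
  "noncritical v E \<longleftrightarrow> (\<forall>x. v x = E \<longrightarrow> grad v x \<noteq> 0)"

text \<open>
  Since \<open>v\<close> is smooth, every \<open>L\<^sub>2\<close> eigenfunction has a smooth representative by elliptic
  regularity, so the eigenvalue equation is imposed pointwise on a \<open>C\<^sup>2\<close> function.  Conversely,
  for \<open>v \<ge> 0\<close> the operator is essentially self-adjoint on the smooth compactly supported
  functions, so such a \<open>\<psi>\<close> automatically lies in the domain of the self-adjoint operator.
\<close>

definition normalized_eigenfunction ::
    "('a::euclidean_space \<Rightarrow> real) \<Rightarrow> real \<Rightarrow> real \<Rightarrow> ('a \<Rightarrow> real) \<Rightarrow> bool" where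
  "normalized_eigenfunction v h E \<psi> \<longleftrightarrow>
     C_k 2 \<psi> \<and>
     (\<forall>x. - h\<^sup>2 * laplacian \<psi> x + v x * \<psi> x = E * \<psi> x) \<and>
     integrable lborel (\<lambda>x. (\<psi> x)\<^sup>2) \<and>
     (\<integral>x. (\<psi> x)\<^sup>2 \<partial>lborel) = 1"

definition potential_energy :: "('a::euclidean_space \<Rightarrow> real) \<Rightarrow> ('a \<Rightarrow> real) \<Rightarrow> real" where
  "potential_energy v \<psi> = (\<integral>x. v x * (\<psi> x)\<^sup>2 \<partial>lborel)"

end

theory Submission
  imports Defs
begin

text \<open>
  The virial identity is applied to the vector field \<open>X = f(v(x)) (x - q(x))\<close>, where \<open>q\<close> is the locally
  constant function equal to \<open>p n\<close> on the well \<open>W n\<close>, and \<open>f\<close> is a \<open>C\<^sup>2\<close> step that cuts off at energies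
  slightly above \<open>E\<^sub>0\<close>.  Compactness and non-criticality of \<open>E\<^sub>0\<close> extend the hypothesis on
  \<open>(x - q) \<bullet> grad v\<close> to these energies with \<open>c\<^sub>0\<close> replaced by \<open>c\<^sub>0 + \<gamma>\<close>.  Hence twice the kinetic energy of
  \<open>\<psi>\<close> below the cut-off is at most \<open>(c\<^sub>0 + \<gamma>) U\<close>, up to terms of size
  \<open>h\<^sup>2 \<integral> (\<psi>\<^sup>2 + \<bar>\<nabla>\<psi>\<bar>\<^sup>2)\<close> over a shell where \<open>v\<close> exceeds \<open>E\<close>.  On that shell \<open>\<psi>\<^sup>2 \<le> v \<psi>\<^sup>2 / E\<^sub>0\<close>, and
  a Caccioppoli inequality bounds \<open>\<integral> \<bar>\<nabla>\<psi>\<bar>\<^sup>2\<close> by \<open>C U\<close>, so the error is at most \<open>C h\<^sup>2 U\<close>; being relative to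
  \<open>U\<close>, it is harmless even when \<open>E\<close> is close to \<open>0\<close>.
\<close>

section \<open>Directional derivatives\<close>

text \<open>Without a cut-off, the field \<open>x - q\<close> would give
  \<open>2 T \<le> c\<^sub>0 U\<close> for the kinetic energy \<open>T\<close>, and
  \<open>T + U = E\<close> then gives \<open>2 E \<le> (2 + c\<^sub>0) U\<close>; this is the origin
  of \<open>2 / (c\<^sub>0 + 2)\<close>. The cut-off is forced because \<open>q\<close> is locally
  constant only on the wells and the hypothesis is silent above \<open>E\<^sub>0\<close>. It also
  makes every integration by parts compactly supported, so nothing about \<psi> at infinity is used
  beyond square integrability. The kinetic energy removed by the cut-off never has to be estimated:
  where the cut-off \<open>F\<close> differs from 1 one has \<open>E \<le> v\<close>, so
  \<open>(1 - F) * (v - E) \<ge> 0\<close> and the energy identity weighted by \<open>F\<close>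
  already bounds \<open>E - U\<close> from above. The step is \<open>C\<^sup>2\<close> because the
  gradient of \<open>div X\<close> enters; the term
  \<open>\<psi> grad (div X) \<bullet> grad \<psi>\<close> is kept as it is, which avoids a third
  derivative of the step. All terms with derivatives of the step are dominated by one bump \<eta> on
  a wider shell, and \<eta> is a square, so that its squared gradient is at most a constant times
  \<eta>, as the Caccioppoli inequality requires.\<close>

definition has_dir_deriv :: "'a::euclidean_space \<Rightarrow> ('a \<Rightarrow> real) \<Rightarrow> real \<Rightarrow> 'a \<Rightarrow> bool" where
  "has_dir_deriv b f D x \<longleftrightarrow> ((\<lambda>t. f (x + t *\<^sub>R b)) has_real_derivative D) (at 0)"

text \<open>The bridge from the total derivative inside \<open>partial_deriv\<close> to derivatives
  along lines. Working along lines reduces the calculus to one-variable rules, and the auxiliary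
  functions built later need no proof of total differentiability.\<close>

lemma has_dir_deriv_partial_deriv:
  assumes "f differentiable_on UNIV"
  shows "has_dir_deriv b f (partial_deriv b f x) x"
proof -
  let ?D = "frechet_derivative f (at x)"
  have d: "(f has_derivative ?D) (at x)"
    using assms by (simp add: differentiable_on_def frechet_derivative_works)
  have l: "((\<lambda>t. x + t *\<^sub>R b) has_derivative (\<lambda>t. t *\<^sub>R b)) (at 0)"
    by (auto intro!: derivative_eq_intros)
  have "((\<lambda>t. f (x + t *\<^sub>R b)) has_derivative (\<lambda>t. ?D (t *\<^sub>R b))) (at 0)"
    using has_derivative_compose[OF l, of f ?D] d by simp
  moreover have "?D (t *\<^sub>R b) = ?D b * t" for t
    using linear_scale[OF linear_frechet_derivative, of f "at x" t b] assms
    by (simp add: differentiable_on_def)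
  ultimately show ?thesis
    by (simp add: has_dir_deriv_def has_field_derivative_def partial_deriv_def)
qed

lemma has_dir_deriv_const: "has_dir_deriv b (\<lambda>x. c) 0 x"
  by (simp add: has_dir_deriv_def)

lemma has_dir_deriv_inner: "has_dir_deriv b (\<lambda>x. x \<bullet> u) (b \<bullet> u) x"
  unfolding has_dir_deriv_def
  by (auto intro!: derivative_eq_intros simp: inner_add_left)

lemma has_dir_deriv_add:
  "has_dir_deriv b f D x \<Longrightarrow> has_dir_deriv b g D' x \<Longrightarrow> has_dir_deriv b (\<lambda>x. f x + g x) (D + D') x"
  unfolding has_dir_deriv_def by (rule DERIV_add)

lemma has_dir_deriv_diff:
  "has_dir_deriv b f D x \<Longrightarrow> has_dir_deriv b g D' x \<Longrightarrow> has_dir_deriv b (\<lambda>x. f x - g x) (D - D') x"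
  unfolding has_dir_deriv_def by (rule DERIV_diff)

lemma has_dir_deriv_mult:
  "has_dir_deriv b f D x \<Longrightarrow> has_dir_deriv b g D' x
    \<Longrightarrow> has_dir_deriv b (\<lambda>x. f x * g x) (D * g x + D' * f x) x"
  unfolding has_dir_deriv_def by (drule (1) DERIV_mult) simp

lemma has_dir_deriv_cmult:
  "has_dir_deriv b f D x \<Longrightarrow> has_dir_deriv b (\<lambda>x. c * f x) (c * D) x"
  unfolding has_dir_deriv_def by (rule DERIV_cmult)

lemma has_dir_deriv_power2:
  "has_dir_deriv b f D x \<Longrightarrow> has_dir_deriv b (\<lambda>x. (f x)\<^sup>2) (2 * f x * D) x"
  using has_dir_deriv_mult[of b f D x f D] by (simp add: power2_eq_square mult_ac)

lemma has_dir_deriv_sum: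
  "(\<And>i. i \<in> I \<Longrightarrow> has_dir_deriv b (f i) (D i) x)
    \<Longrightarrow> has_dir_deriv b (\<lambda>x. \<Sum>i\<in>I. f i x) (\<Sum>i\<in>I. D i) x"
  unfolding has_dir_deriv_def by (rule DERIV_sum)

lemma has_dir_deriv_chain:
  assumes "(k has_real_derivative k') (at (f x))" "has_dir_deriv b f D x"
  shows "has_dir_deriv b (\<lambda>x. k (f x)) (k' * D) x"
  using DERIV_chain2[of k k' "\<lambda>t. f (x + t *\<^sub>R b)" 0 D UNIV] assms
  unfolding has_dir_deriv_def by simp

text \<open>For small \<open>t\<close> the point \<open>x + t *\<^sub>R b\<close> stays in
  \<open>S\<close>. This locality is what later allows a locally constant function to be treated as
  a constant.\<close>

lemma has_dir_deriv_transform: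
  assumes "has_dir_deriv b f D x" "open S" "x \<in> S" "\<And>y. y \<in> S \<Longrightarrow> f y = g y"
  shows "has_dir_deriv b g D x"
proof -
  have "((\<lambda>t. x + t *\<^sub>R b) \<longlongrightarrow> x + 0 *\<^sub>R b) (at 0)"
    by (intro tendsto_intros)
  then have "eventually (\<lambda>t. x + t *\<^sub>R b \<in> S) (at 0)"
    using assms(2,3) by (intro topological_tendstoD) auto
  then have "eventually (\<lambda>t. f (x + t *\<^sub>R b) = g (x + t *\<^sub>R b)) (at 0)"
    by eventually_elim (simp add: assms)
  then have "eventually (\<lambda>t. f (x + t *\<^sub>R b) = g (x + t *\<^sub>R b)) (nhds 0)"
    using assms by (simp add: eventually_nhds_conv_at)
  then show ?thesis
    using assms(1) unfolding has_dir_deriv_def by (subst DERIV_cong_ev[symmetric]) auto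
qed

lemma has_dir_deriv_line:
  assumes "\<And>x. has_dir_deriv b f (f' x) x"
  shows "((\<lambda>t. f (x + t *\<^sub>R b)) has_real_derivative f' (x + t *\<^sub>R b)) (at t)"
  using assms[of "x + t *\<^sub>R b"] DERIV_shift[of "\<lambda>t. f (x + t *\<^sub>R b)" "f' (x + t *\<^sub>R b)" 0 t]
  by (simp add: has_dir_deriv_def algebra_simps)

section \<open>Symmetry of mixed second derivatives\<close>

text \<open>The mean value theorem is used twice: along \<open>i\<close> for the difference between
  \<open>f\<close> and its shift by \<open>h *\<^sub>R j\<close>, then along \<open>j\<close> for
  \<open>fi\<close>.\<close>

lemma second_difference_eq_mixed_deriv:
  assumes 1: "\<And>x. has_dir_deriv i f (fi x) x" and 2: "\<And>x. has_dir_deriv j fi (fij x) x" and "0 < h"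
  shows "\<exists>s t. 0 < s \<and> s < h \<and> 0 < t \<and> t < h \<and>
    f (x + h *\<^sub>R i + h *\<^sub>R j) - f (x + h *\<^sub>R i) - f (x + h *\<^sub>R j) + f x
      = h * h * fij (x + s *\<^sub>R i + t *\<^sub>R j)"
proof -
  let ?g = "\<lambda>s. f ((x + h *\<^sub>R j) + s *\<^sub>R i) - f (x + s *\<^sub>R i)"
  have "\<exists>s::real. s > 0 \<and> s < h \<and> ?g h - ?g 0
      = (h - 0) * (fi ((x + h *\<^sub>R j) + s *\<^sub>R i) - fi (x + s *\<^sub>R i))"
    by (rule MVT2[OF \<open>0 < h\<close>]) (intro DERIV_diff has_dir_deriv_line 1)
  then obtain s where s: "0 < s" "s < h"
    "?g h - ?g 0 = h * (fi ((x + h *\<^sub>R j) + s *\<^sub>R i) - fi (x + s *\<^sub>R i))"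
    by auto
  have "\<exists>t::real. t > 0 \<and> t < h \<and> fi ((x + s *\<^sub>R i) + h *\<^sub>R j) - fi ((x + s *\<^sub>R i) + 0 *\<^sub>R j)
      = (h - 0) * fij ((x + s *\<^sub>R i) + t *\<^sub>R j)"
    by (rule MVT2[OF \<open>0 < h\<close>]) (intro has_dir_deriv_line 2)
  then obtain t where "0 < t" "t < h"
    "fi ((x + s *\<^sub>R i) + h *\<^sub>R j) - fi (x + s *\<^sub>R i) = h * fij ((x + s *\<^sub>R i) + t *\<^sub>R j)"
    by auto
  with s show ?thesis
    by (intro exI[of _ s] exI[of _ t]) (simp add: algebra_simps)
qed

text \<open>Schwarz's theorem. The second difference is symmetric in \<open>i\<close> and
  \<open>j\<close>, so for each step \<open>h n\<close> the two mixed derivatives agree at two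
  intermediate points; these converge to \<open>x\<close>, and continuity gives equality
  there.\<close>

lemma mixed_dir_deriv_commute:
  fixes f :: "'a::euclidean_space \<Rightarrow> real"
  assumes "\<And>x. has_dir_deriv i f (fi x) x" "\<And>x. has_dir_deriv j f (fj x) x"
    and "\<And>x. has_dir_deriv j fi (fij x) x" "\<And>x. has_dir_deriv i fj (fji x) x"
    and cont: "continuous_on UNIV fij" "continuous_on UNIV fji"
  shows "fij x = fji x"
proof -
  define h where "h n = inverse (real (Suc n))" for n
  have h: "0 < h n" for n by (simp add: h_def)
  have h0: "h \<longlonglongrightarrow> 0" unfolding h_def by (rule LIMSEQ_inverse_real_of_nat)
  have "\<exists>s t s' t'. 0 < s \<and> s < h n \<and> 0 < t \<and> t < h n \<and> 0 < s' \<and> s' < h n \<and> 0 < t' \<and> t' < h n \<and>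
      fij (x + s *\<^sub>R i + t *\<^sub>R j) = fji (x + s' *\<^sub>R j + t' *\<^sub>R i)" for n
  proof -
    obtain s t where 1: "0 < s" "s < h n" "0 < t" "t < h n"
      "f (x + h n *\<^sub>R i + h n *\<^sub>R j) - f (x + h n *\<^sub>R i) - f (x + h n *\<^sub>R j) + f x
        = h n * h n * fij (x + s *\<^sub>R i + t *\<^sub>R j)"
      using second_difference_eq_mixed_deriv[of i f fi j fij "h n" x] assms h by blast
    obtain s' t' where 2: "0 < s'" "s' < h n" "0 < t'" "t' < h n"
      "f (x + h n *\<^sub>R j + h n *\<^sub>R i) - f (x + h n *\<^sub>R j) - f (x + h n *\<^sub>R i) + f x
        = h n * h n * fji (x + s' *\<^sub>R j + t' *\<^sub>R i)"
      using second_difference_eq_mixed_deriv[of j f fj i fji "h n" x] assms h by blast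
    have "x + h n *\<^sub>R j + h n *\<^sub>R i = x + h n *\<^sub>R i + h n *\<^sub>R j" by simp
    then have "f (x + h n *\<^sub>R j + h n *\<^sub>R i) = f (x + h n *\<^sub>R i + h n *\<^sub>R j)" by (rule arg_cong)
    then have "h n * h n * fij (x + s *\<^sub>R i + t *\<^sub>R j) = h n * h n * fji (x + s' *\<^sub>R j + t' *\<^sub>R i)"
      using 1(5) 2(5) by linarith
    then have "fij (x + s *\<^sub>R i + t *\<^sub>R j) = fji (x + s' *\<^sub>R j + t' *\<^sub>R i)"
      using h[of n] by simp
    with 1 2 show ?thesis by blast
  qed
  then obtain s t s' t' where *: "\<And>n. 0 < s n \<and> s n < h n \<and> 0 < t n \<and> t n < h n \<and>
      0 < s' n \<and> s' n < h n \<and> 0 < t' n \<and> t' n < h n \<and>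
      fij (x + s n *\<^sub>R i + t n *\<^sub>R j) = fji (x + s' n *\<^sub>R j + t' n *\<^sub>R i)"
    by metis
  have lim: "r \<longlonglongrightarrow> 0" if "\<And>n. 0 < r n \<and> r n < h n" for r :: "nat \<Rightarrow> real"
    by (rule tendsto_sandwich[OF _ _ tendsto_const h0])
       (use that in \<open>auto intro!: always_eventually less_imp_le\<close>)
  have lims: "s \<longlonglongrightarrow> 0" "t \<longlonglongrightarrow> 0" "s' \<longlonglongrightarrow> 0" "t' \<longlonglongrightarrow> 0"
    using * by (auto intro!: lim)
  have A: "(\<lambda>n. fij (x + s n *\<^sub>R i + t n *\<^sub>R j)) \<longlonglongrightarrow> fij (x + 0 *\<^sub>R i + 0 *\<^sub>R j)"
    by (rule continuous_on_tendsto_compose[OF cont(1)])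
       (intro tendsto_intros lims, auto)
  have B: "(\<lambda>n. fji (x + s' n *\<^sub>R j + t' n *\<^sub>R i)) \<longlonglongrightarrow> fji (x + 0 *\<^sub>R j + 0 *\<^sub>R i)"
    by (rule continuous_on_tendsto_compose[OF cont(2)])
       (intro tendsto_intros lims, auto)
  have "(\<lambda>n. fij (x + s n *\<^sub>R i + t n *\<^sub>R j)) = (\<lambda>n. fji (x + s' n *\<^sub>R j + t' n *\<^sub>R i))"
    using * by blast
  then show ?thesis using LIMSEQ_unique[OF A] B by simp
qed

section \<open>Integration by parts for compactly supported functions\<close>

lemma integrable_continuous_compact_support:
  fixes f :: "'a::euclidean_space \<Rightarrow> real"
  assumes "continuous_on UNIV f" "compact K" "\<And>x. x \<notin> K \<Longrightarrow> f x = 0"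
  shows "integrable lborel f"
proof -
  have "integrable lborel (\<lambda>x. indicator K x *\<^sub>R f x)"
    using assms by (intro borel_integrable_compact) (auto intro: continuous_on_subset)
  also have "(\<lambda>x. indicator K x *\<^sub>R f x) = f"
    using assms(3) by (intro ext) (auto simp: indicator_def)
  finally show ?thesis .
qed

lemma bounded_continuous_compact_support:
  fixes f :: "'a::euclidean_space \<Rightarrow> real"
  assumes "continuous_on UNIV f" "compact K" "\<And>x. x \<notin> K \<Longrightarrow> f x = 0"
  obtains B where "B > 0" "\<And>x. \<bar>f x\<bar> \<le> B"
proof -
  have "compact (f ` K)"
    using assms by (intro compact_continuous_image) (auto intro: continuous_on_subset)
  then obtain B where "B > 0" "\<forall>y\<in>f ` K. norm y \<le> B"
    using compact_imp_bounded bounded_pos by metis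
  moreover have "\<bar>f x\<bar> \<le> B" for x
    using calculation assms(3) by (cases "x \<in> K") auto
  ultimately show ?thesis using that by blast
qed

lemma lborel_integral_translate:
  fixes f :: "'a::euclidean_space \<Rightarrow> real"
  assumes "f \<in> borel_measurable borel"
  shows "(\<integral>x. f (x + c) \<partial>lborel) = (\<integral>x. f x \<partial>lborel)"
proof -
  have "(\<integral>x. f x \<partial>lborel) = (\<integral>x. f x \<partial>(distr lborel borel ((+) c)))"
    by (simp add: lborel_distr_plus)
  also have "\<dots> = (\<integral>x. f (c + x) \<partial>lborel)"
    using assms by (intro integral_distr) auto
  finally show ?thesis by (simp add: add.commute)
qed

text \<open>By translation invariance all difference quotients have integral zero; the derivative is
  their dominated limit.\<close>

lemma integral_dir_deriv_eq_0:
  fixes f :: "'a::euclidean_space \<Rightarrow> real"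
  assumes d: "\<And>x. has_dir_deriv b f (f' x) x"
    and f: "continuous_on UNIV f" and f': "continuous_on UNIV f'"
    and K: "compact K" "\<And>x. x \<notin> K \<Longrightarrow> f x = 0" "\<And>x. x \<notin> K \<Longrightarrow> f' x = 0"
  shows "(\<integral>x. f' x \<partial>lborel) = 0"
proof -
  obtain B where B: "B > 0" "\<And>x. \<bar>f' x\<bar> \<le> B"
    using bounded_continuous_compact_support[OF f' K(1,3)] by blast
  define h where "h n = inverse (real (Suc n))" for n
  have h: "0 < h n" "h n \<le> 1" for n by (simp_all add: h_def field_simps)
  have h0: "h \<longlonglongrightarrow> 0" unfolding h_def by (rule LIMSEQ_inverse_real_of_nat)
  define s where "s n x = (f (x + h n *\<^sub>R b) - f x) / h n" for n x
  \<comment> \<open>\<open>K1\<close> is \<open>K\<close> swept backwards along \<open>b\<close> by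
    steps of length at most 1. All difference quotients \<open>s n\<close> vanish outside it, so one
    integrable function dominates them all.\<close>
  define K1 where "K1 = {x + y |x y. x \<in> K \<and> y \<in> (\<lambda>t. t *\<^sub>R b) ` {-1..0::real}}"
  have K1: "compact K1"
    unfolding K1_def by (intro compact_sums K compact_continuous_image continuous_intros) auto
  have notK: "x + t *\<^sub>R b \<notin> K" if "x \<notin> K1" "0 \<le> t" "t \<le> 1" for x t
  proof
    assume "x + t *\<^sub>R b \<in> K"
    then have "(x + t *\<^sub>R b) + (- t) *\<^sub>R b \<in> K1"
      unfolding K1_def using that by fastforce
    then show False using that by simp
  qed
  have s_le: "\<bar>s n x\<bar> \<le> B * indicator K1 x" for n x
  proof (cases "x \<in> K1")
    case True
    obtain t where "f (x + h n *\<^sub>R b) - f (x + 0 *\<^sub>R b) = (h n - 0) * f' (x + t *\<^sub>R b)"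
      using MVT2[OF h(1)[of n] has_dir_deriv_line[OF d]] by blast
    then have "s n x = f' (x + t *\<^sub>R b)" using h[of n] by (simp add: s_def)
    then show ?thesis using B True by simp
  next
    case False
    then show ?thesis
      using notK[of x 0] notK[of x "h n"] h[of n] K(2) by (simp add: s_def)
  qed
  have ms: "f \<in> borel_measurable borel" "f' \<in> borel_measurable borel"
    using f f' by (auto intro: borel_measurable_continuous_onI)
  have intf: "integrable lborel f"
    by (rule integrable_continuous_compact_support[OF f K(1,2)])
  have ift: "integrable lborel (\<lambda>x. f (x + c))" for c
  proof (rule integrable_continuous_compact_support)
    show "continuous_on UNIV (\<lambda>x. f (x + c))"
      by (intro continuous_on_compose2[OF f] continuous_intros) auto
    show "compact ((\<lambda>x. x - c) ` K)"
      by (intro compact_continuous_image continuous_intros K)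
    show "f (x + c) = 0" if "x \<notin> (\<lambda>x. x - c) ` K" for x
      using that K(2)[of "x + c"] by force
  qed
  have s0: "(\<integral>x. s n x \<partial>lborel) = 0" for n
    unfolding s_def using intf ift lborel_integral_translate[OF ms(1)] by simp
  have "(\<lambda>n. \<integral>x. s n x \<partial>lborel) \<longlonglongrightarrow> (\<integral>x. f' x \<partial>lborel)"
  proof (rule integral_dominated_convergence)
    show "f' \<in> borel_measurable lborel" using ms by simp
    show "s n \<in> borel_measurable lborel" for n
      unfolding s_def using ms by measurable
    show "integrable lborel (\<lambda>x. B * indicator K1 x)"
      using K1 emeasure_compact_finite[OF K1]
      by (intro integrable_mult_right integrable_real_indicator) (auto simp: compact_imp_closed)
    show "AE x in lborel. norm (s n x) \<le> B * indicator K1 x" for n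
      using s_le by simp
    show "AE x in lborel. (\<lambda>n. s n x) \<longlonglongrightarrow> f' x"
    proof (rule AE_I2)
      fix x
      have "((\<lambda>t. (f (x + t *\<^sub>R b) - f x) / t) \<longlongrightarrow> f' x) (at 0)"
        using d[of x] by (simp add: has_dir_deriv_def DERIV_def)
      moreover have "filterlim h (at 0) sequentially"
        using h0 h(1) by (auto simp: filterlim_at less_imp_neq[symmetric] intro!: always_eventually)
      ultimately show "(\<lambda>n. s n x) \<longlonglongrightarrow> f' x"
        unfolding s_def by (rule filterlim_compose)
    qed
  qed
  then have "(\<lambda>n::nat. 0) \<longlonglongrightarrow> (\<integral>x. f' x \<partial>lborel)" unfolding s0 .
  then show ?thesis by (simp add: tendsto_const_iff)
qed

lemma C_k_Suc_imp:
  assumes "C_k (Suc k) f" shows "C_k k f"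
  using assms
  by (induction k arbitrary: f)
     (auto simp: differentiable_on_def continuous_on_eq_continuous_at differentiable_imp_continuous_within)

lemma C_k_imp_continuous: "C_k k f \<Longrightarrow> continuous_on UNIV f"
  by (induction k) (auto dest: C_k_Suc_imp simp del: C_k.simps(2))

lemma C_k_Suc_has_dir_deriv: "C_k (Suc k) f \<Longrightarrow> has_dir_deriv b f (partial_deriv b f x) x"
  by (simp add: has_dir_deriv_partial_deriv)

lemma integral_divergence_eq_0:
  fixes Y :: "'a::euclidean_space \<Rightarrow> 'a \<Rightarrow> real"
  assumes "\<And>b x. b \<in> Basis \<Longrightarrow> has_dir_deriv b (Y b) (Y' b x) x"
    and "\<And>b. b \<in> Basis \<Longrightarrow> continuous_on UNIV (Y b)"
    and "\<And>b. b \<in> Basis \<Longrightarrow> continuous_on UNIV (Y' b)"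
    and "compact K" "\<And>b x. b \<in> Basis \<Longrightarrow> x \<notin> K \<Longrightarrow> Y b x = 0"
    and "\<And>b x. b \<in> Basis \<Longrightarrow> x \<notin> K \<Longrightarrow> Y' b x = 0"
  shows "(\<integral>x. (\<Sum>b\<in>Basis. Y' b x) \<partial>lborel) = 0"
proof -
  have "(\<integral>x. (\<Sum>b\<in>Basis. Y' b x) \<partial>lborel) = (\<Sum>b\<in>Basis. \<integral>x. Y' b x \<partial>lborel)"
    by (intro Bochner_Integration.integral_sum integrable_continuous_compact_support[of _ K] assms) auto
  also have "\<dots> = 0"
    by (intro sum.neutral ballI, rule integral_dir_deriv_eq_0[OF assms(1-4)]) (auto simp: assms)
  finally show ?thesis .
qed

section \<open>Energy and virial identities\<close>

locale eigenfunction =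
  fixes v :: "'a::euclidean_space \<Rightarrow> real" and h E :: real and \<psi> :: "'a \<Rightarrow> real"
  assumes v_smooth: "C_infinity v" and v_nonneg: "\<And>x. 0 \<le> v x"
    and h_pos: "0 < h" and eigen: "normalized_eigenfunction v h E \<psi>"
begin

abbreviation "dv \<equiv> \<lambda>b. partial_deriv b v"
abbreviation "d\<psi> \<equiv> \<lambda>b. partial_deriv b \<psi>"
abbreviation "dd\<psi> \<equiv> \<lambda>j b. partial_deriv b (partial_deriv j \<psi>)"

definition "G x = (\<Sum>b\<in>Basis. (d\<psi> b x)\<^sup>2)"

lemma C2_\<psi>: "C_k (Suc (Suc 0)) \<psi>"
  using eigen by (simp add: normalized_eigenfunction_def numeral_2_eq_2)

lemma C1_d\<psi>: "b \<in> Basis \<Longrightarrow> C_k (Suc 0) (d\<psi> b)"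
  using C2_\<psi> by (metis C_k.simps(2))

lemma Cv: "C_k k v"
  using v_smooth by (simp add: C_infinity_def)

lemma Cdv: "b \<in> Basis \<Longrightarrow> C_k k (dv b)"
  using Cv[of "Suc k"] by simp

lemma cont_v [continuous_intros]: "continuous_on UNIV v"
  by (rule C_k_imp_continuous[OF Cv])
lemma cont_dv [continuous_intros]: "b \<in> Basis \<Longrightarrow> continuous_on UNIV (dv b)"
  by (rule C_k_imp_continuous[OF Cdv])
lemma cont_\<psi> [continuous_intros]: "continuous_on UNIV \<psi>"
  by (rule C_k_imp_continuous[OF C2_\<psi>])
lemma cont_d\<psi> [continuous_intros]: "b \<in> Basis \<Longrightarrow> continuous_on UNIV (d\<psi> b)"
  by (rule C_k_imp_continuous[OF C1_d\<psi>])
lemma cont_dd\<psi> [continuous_intros]: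
  "j \<in> Basis \<Longrightarrow> b \<in> Basis \<Longrightarrow> continuous_on UNIV (dd\<psi> j b)"
  using C1_d\<psi>[of j] by simp
lemma cont_G [continuous_intros]: "continuous_on UNIV G"
  unfolding G_def by (intro continuous_intros)

lemma dir_deriv_v: "has_dir_deriv b v (dv b x) x"
  by (rule C_k_Suc_has_dir_deriv[OF Cv])
lemma dir_deriv_\<psi>: "has_dir_deriv b \<psi> (d\<psi> b x) x"
  by (rule C_k_Suc_has_dir_deriv[OF C2_\<psi>])
lemma dir_deriv_d\<psi>: "j \<in> Basis \<Longrightarrow> has_dir_deriv b (d\<psi> j) (dd\<psi> j b x) x"
  by (rule C_k_Suc_has_dir_deriv[OF C1_d\<psi>])

lemma dd\<psi>_commute: "j \<in> Basis \<Longrightarrow> b \<in> Basis \<Longrightarrow> dd\<psi> j b x = dd\<psi> b j x"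
  by (rule mixed_dir_deriv_commute)
     (rule dir_deriv_\<psi> dir_deriv_d\<psi> cont_dd\<psi>; assumption)+

lemma eigen_eq: "h\<^sup>2 * (\<Sum>b\<in>Basis. dd\<psi> b b x) = (v x - E) * \<psi> x"
proof -
  have "- h\<^sup>2 * laplacian \<psi> x + v x * \<psi> x = E * \<psi> x"
    using eigen by (simp only: normalized_eigenfunction_def)
  then show ?thesis by (simp add: laplacian_def algebra_simps)
qed

lemma integrable_sq: "integrable lborel (\<lambda>x. (\<psi> x)\<^sup>2)"
  and integral_sq: "(\<integral>x. (\<psi> x)\<^sup>2 \<partial>lborel) = 1"
  using eigen by (simp_all add: normalized_eigenfunction_def)

text \<open>The eigenvalue equation tested against \<open>\<eta> \<psi>\<close>: the field
  \<open>h\<^sup>2 \<eta> \<psi> grad \<psi>\<close> has compact support, so its divergence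
  integrates to zero, and \<open>eigen_eq\<close> replaces the Laplacian.\<close>

lemma energy_identity:
  assumes d: "\<And>b x. b \<in> Basis \<Longrightarrow> has_dir_deriv b \<eta> (\<eta>' b x) x"
    and c [continuous_intros]: "continuous_on UNIV \<eta>" "\<And>b. b \<in> Basis \<Longrightarrow> continuous_on UNIV (\<eta>' b)"
    and K: "compact K" "\<And>x. x \<notin> K \<Longrightarrow> \<eta> x = 0" "\<And>b x. b \<in> Basis \<Longrightarrow> x \<notin> K \<Longrightarrow> \<eta>' b x = 0"
  shows "h\<^sup>2 * (\<integral>x. \<eta> x * G x \<partial>lborel) + h\<^sup>2 * (\<integral>x. \<psi> x * (\<Sum>b\<in>Basis. \<eta>' b x * d\<psi> b x) \<partial>lborel)
    + (\<integral>x. (v x - E) * (\<eta> x * (\<psi> x)\<^sup>2) \<partial>lborel) = 0"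
proof -
  define Y' where "Y' b x = h\<^sup>2 * ((\<eta>' b x * \<psi> x + d\<psi> b x * \<eta> x) * d\<psi> b x + dd\<psi> b b x * (\<eta> x * \<psi> x))"
    for b x
  have "(\<integral>x. (\<Sum>b\<in>Basis. Y' b x) \<partial>lborel) = 0"
  proof (rule integral_divergence_eq_0[of "\<lambda>b x. h\<^sup>2 * ((\<eta> x * \<psi> x) * d\<psi> b x)" Y' K])
    show "has_dir_deriv b (\<lambda>x. h\<^sup>2 * ((\<eta> x * \<psi> x) * d\<psi> b x)) (Y' b x) x" if "b \<in> Basis" for b x
      unfolding Y'_def
      by (intro has_dir_deriv_cmult has_dir_deriv_mult d dir_deriv_\<psi> dir_deriv_d\<psi> that)
    show "continuous_on UNIV (\<lambda>x. h\<^sup>2 * ((\<eta> x * \<psi> x) * d\<psi> b x))" if "b \<in> Basis" for b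
      by (intro continuous_intros that)
    show "continuous_on UNIV (Y' b)" if "b \<in> Basis" for b
      unfolding Y'_def by (intro continuous_intros that)
  qed (simp_all add: K Y'_def)
  moreover have "(\<Sum>b\<in>Basis. Y' b x) = h\<^sup>2 * (\<eta> x * G x)
      + h\<^sup>2 * (\<psi> x * (\<Sum>b\<in>Basis. \<eta>' b x * d\<psi> b x)) + (v x - E) * (\<eta> x * (\<psi> x)\<^sup>2)" for x
  proof -
    have "(\<Sum>b\<in>Basis. Y' b x) = h\<^sup>2 * (\<eta> x * G x) + h\<^sup>2 * (\<psi> x * (\<Sum>b\<in>Basis. \<eta>' b x * d\<psi> b x))
        + (h\<^sup>2 * (\<Sum>b\<in>Basis. dd\<psi> b b x)) * (\<eta> x * \<psi> x)"
      unfolding Y'_def G_def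
      by (simp add: sum.distrib sum_distrib_left sum_distrib_right algebra_simps power2_eq_square)
    then show ?thesis unfolding eigen_eq by (simp add: power2_eq_square mult_ac)
  qed
  moreover have "integrable lborel (\<lambda>x. \<eta> x * G x)"
    "integrable lborel (\<lambda>x. \<psi> x * (\<Sum>b\<in>Basis. \<eta>' b x * d\<psi> b x))"
    "integrable lborel (\<lambda>x. (v x - E) * (\<eta> x * (\<psi> x)\<^sup>2))"
    by (rule integrable_continuous_compact_support[OF _ K(1)],
        (intro continuous_intros; assumption), simp add: K)+
  ultimately show ?thesis by simp
qed

text \<open>The eigenvalue equation tested against
  \<open>2 X \<bullet> grad \<psi> + (div X) \<psi>\<close>. The second summand removes the terms
  \<open>div X\<close> times \<open>G\<close> and \<open>div X\<close> times
  \<open>(v - E) \<psi>\<^sup>2\<close>. A second derivative of \<open>X\<close> enters only through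
  the gradient \<open>g'\<close> of the divergence, hence the separate hypothesis \<open>dg\<close>
  on the trace.\<close>

lemma virial_identity:
  fixes X :: "'a \<Rightarrow> 'a \<Rightarrow> real"
  assumes dX: "\<And>j b x. j \<in> Basis \<Longrightarrow> b \<in> Basis \<Longrightarrow> has_dir_deriv b (X j) (X' j b x) x"
    and dg: "\<And>b x. b \<in> Basis \<Longrightarrow> has_dir_deriv b (\<lambda>x. \<Sum>b\<in>Basis. X' b b x) (g' b x) x"
    and c [continuous_intros]: "\<And>j. j \<in> Basis \<Longrightarrow> continuous_on UNIV (X j)"
      "\<And>j b. j \<in> Basis \<Longrightarrow> b \<in> Basis \<Longrightarrow> continuous_on UNIV (X' j b)"
      "\<And>b. b \<in> Basis \<Longrightarrow> continuous_on UNIV (g' b)"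
    and K: "compact K" "\<And>j x. j \<in> Basis \<Longrightarrow> x \<notin> K \<Longrightarrow> X j x = 0"
      "\<And>j b x. j \<in> Basis \<Longrightarrow> b \<in> Basis \<Longrightarrow> x \<notin> K \<Longrightarrow> X' j b x = 0"
      "\<And>b x. b \<in> Basis \<Longrightarrow> x \<notin> K \<Longrightarrow> g' b x = 0"
  shows "2 * h\<^sup>2 * (\<integral>x. (\<Sum>b\<in>Basis. \<Sum>j\<in>Basis. X' j b x * d\<psi> j x * d\<psi> b x) \<partial>lborel)
      + h\<^sup>2 * (\<integral>x. \<psi> x * (\<Sum>b\<in>Basis. g' b x * d\<psi> b x) \<partial>lborel)
    = (\<integral>x. (\<Sum>b\<in>Basis. X b x * dv b x) * (\<psi> x)\<^sup>2 \<partial>lborel)"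
proof -
  define g where "g x = (\<Sum>b\<in>Basis. X' b b x)" for x
  define S where "S x = (\<Sum>j\<in>Basis. X j x * d\<psi> j x)" for x
  define S' where "S' b x = (\<Sum>j\<in>Basis. X' j b x * d\<psi> j x + dd\<psi> j b x * X j x)" for b x
  define G' where "G' b x = (\<Sum>j\<in>Basis. 2 * d\<psi> j x * dd\<psi> j b x)" for b x
  have dg': "has_dir_deriv b g (g' b x) x" if "b \<in> Basis" for b x
    unfolding g_def by (rule dg[OF that])
  have dS: "has_dir_deriv b S (S' b x) x" if "b \<in> Basis" for b x
    unfolding S_def S'_def
    by (intro has_dir_deriv_sum has_dir_deriv_mult dX dir_deriv_d\<psi> that; assumption)
  have dG: "has_dir_deriv b G (G' b x) x" if "b \<in> Basis" for b x
    unfolding G_def G'_def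
    by (intro has_dir_deriv_sum has_dir_deriv_power2 dir_deriv_d\<psi> that; assumption)
  have cg [continuous_intros]: "continuous_on UNIV g" "continuous_on UNIV S"
    unfolding g_def S_def by (intro continuous_intros; assumption)+
  have cS [continuous_intros]: "continuous_on UNIV (S' b)" "continuous_on UNIV (G' b)" if "b \<in> Basis" for b
    unfolding S'_def G'_def by (intro continuous_intros that; assumption)+
  \<comment> \<open>The flux whose divergence is the tested equation: the two terms with
    \<open>S\<close> and \<open>G\<close> form the stress tensor of \<psi> applied to
    \<open>X\<close>, the term with \<open>g\<close> comes from the summand
    \<open>(div X) \<psi>\<close> of the multiplier.\<close>
  define Y where "Y b x = h\<^sup>2 * (2 * (S x * d\<psi> b x) - G x * X b x + (g x * \<psi> x) * d\<psi> b x)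
    - ((v x - E) * (\<psi> x)\<^sup>2) * X b x" for b x
  define Y' where "Y' b x =
    h\<^sup>2 * (2 * (S' b x * d\<psi> b x + dd\<psi> b b x * S x) - (G' b x * X b x + X' b b x * G x)
        + ((g' b x * \<psi> x + d\<psi> b x * g x) * d\<psi> b x + dd\<psi> b b x * (g x * \<psi> x)))
    - (((dv b x - 0) * (\<psi> x)\<^sup>2 + 2 * \<psi> x * d\<psi> b x * (v x - E)) * X b x
        + X' b b x * ((v x - E) * (\<psi> x)\<^sup>2))" for b x
  have z: "g x = 0" "S x = 0" "b \<in> Basis \<Longrightarrow> S' b x = 0" if "x \<notin> K" for b x
    using K that by (simp_all add: g_def S_def S'_def)
  have "(\<integral>x. (\<Sum>b\<in>Basis. Y' b x) \<partial>lborel) = 0"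
  proof (rule integral_divergence_eq_0[of Y Y' K])
    show "has_dir_deriv b (Y b) (Y' b x) x" if "b \<in> Basis" for b x
      unfolding Y_def Y'_def
      by (intro has_dir_deriv_cmult has_dir_deriv_mult has_dir_deriv_diff has_dir_deriv_add
            has_dir_deriv_power2 has_dir_deriv_const dX dg' dS dG dir_deriv_v dir_deriv_\<psi> dir_deriv_d\<psi> that)
    show "continuous_on UNIV (Y b)" if "b \<in> Basis" for b
      unfolding Y_def by (intro continuous_intros that)
    show "continuous_on UNIV (Y' b)" if "b \<in> Basis" for b
      unfolding Y'_def by (intro continuous_intros that)
    show "Y b x = 0" if "b \<in> Basis" "x \<notin> K" for b x
      unfolding Y_def using that z K by simp
    show "Y' b x = 0" if "b \<in> Basis" "x \<notin> K" for b x
      unfolding Y'_def using that z K by simp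
  qed (rule K)
  moreover have "(\<Sum>b\<in>Basis. Y' b x) =
      2 * h\<^sup>2 * (\<Sum>b\<in>Basis. \<Sum>j\<in>Basis. X' j b x * d\<psi> j x * d\<psi> b x)
      + h\<^sup>2 * (\<psi> x * (\<Sum>b\<in>Basis. g' b x * d\<psi> b x))
      - (\<Sum>b\<in>Basis. X b x * dv b x) * (\<psi> x)\<^sup>2" for x
  proof -
    define L where "L = (\<Sum>b\<in>Basis. dd\<psi> b b x)"
    define A where "A = (\<Sum>b\<in>Basis. \<Sum>j\<in>Basis. X' j b x * d\<psi> j x * d\<psi> b x)"
    define H where "H = (\<Sum>b\<in>Basis. \<Sum>j\<in>Basis. dd\<psi> j b x * X j x * d\<psi> b x)"
    define P where "P = (\<Sum>b\<in>Basis. g' b x * d\<psi> b x)"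
    define V where "V = (\<Sum>b\<in>Basis. X b x * dv b x)"
    have 1: "(\<Sum>b\<in>Basis. S' b x * d\<psi> b x) = A + H"
      by (simp add: S'_def A_def H_def sum_distrib_right sum_distrib_left sum.distrib algebra_simps)
    \<comment> \<open>Symmetry of the Hessian of \<psi> identifies the second-order part of
      \<open>grad S \<bullet> grad \<psi>\<close> with half of \<open>grad G \<bullet> X\<close>, so
      these terms cancel.\<close>
    have "H = (\<Sum>j\<in>Basis. \<Sum>b\<in>Basis. dd\<psi> b j x * X j x * d\<psi> b x)"
      unfolding H_def by (subst sum.swap) (intro sum.cong refl, simp add: dd\<psi>_commute)
    also have "2 * \<dots> = (\<Sum>b\<in>Basis. G' b x * X b x)"
      by (simp add: G'_def sum_distrib_left sum_distrib_right mult_ac)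
    finally have 2: "(\<Sum>b\<in>Basis. G' b x * X b x) = 2 * H" by simp
    have "(\<Sum>b\<in>Basis. Y' b x) = (\<Sum>b\<in>Basis. 
        h\<^sup>2 * (2 * (S' b x * d\<psi> b x) + 2 * S x * dd\<psi> b b x - G' b x * X b x - G x * X' b b x
          + \<psi> x * (g' b x * d\<psi> b x) + g x * (d\<psi> b x)\<^sup>2 + (g x * \<psi> x) * dd\<psi> b b x)
        - (\<psi> x)\<^sup>2 * (X b x * dv b x) - (2 * \<psi> x * (v x - E)) * (X b x * d\<psi> b x)
        - ((v x - E) * (\<psi> x)\<^sup>2) * X' b b x)"
      unfolding Y'_def by (intro sum.cong refl) (simp add: algebra_simps power2_eq_square)
    also have "\<dots> = h\<^sup>2 * (2 * (\<Sum>b\<in>Basis. S' b x * d\<psi> b x) + 2 * S x * L - (\<Sum>b\<in>Basis. G' b x * X b x)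
        - G x * g x + \<psi> x * P + g x * G x + (g x * \<psi> x) * L)
        - (\<psi> x)\<^sup>2 * V - (2 * \<psi> x * (v x - E)) * S x - ((v x - E) * (\<psi> x)\<^sup>2) * g x"
      unfolding L_def P_def V_def G_def[of x] g_def[of x] S_def[of x]
      by (simp only: sum.distrib sum_subtractf sum_distrib_left[symmetric])
    \<comment> \<open>What is left over factors as the eigenvalue equation times the multiplier
      \<open>2 S + g \<psi>\<close>, and so vanishes.\<close>
    also have "\<dots> = 2 * h\<^sup>2 * A + h\<^sup>2 * (\<psi> x * P) - V * (\<psi> x)\<^sup>2
        + (h\<^sup>2 * L - (v x - E) * \<psi> x) * (2 * S x + g x * \<psi> x)"
      unfolding 1 2 by (simp add: algebra_simps power2_eq_square)
    finally show ?thesis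
      unfolding A_def P_def V_def using eigen_eq[of x] by (simp add: L_def)
  qed
  moreover have "integrable lborel (\<lambda>x. \<Sum>b\<in>Basis. \<Sum>j\<in>Basis. X' j b x * d\<psi> j x * d\<psi> b x)"
    "integrable lborel (\<lambda>x. \<psi> x * (\<Sum>b\<in>Basis. g' b x * d\<psi> b x))"
    "integrable lborel (\<lambda>x. (\<Sum>b\<in>Basis. X b x * dv b x) * (\<psi> x)\<^sup>2)"
    by (rule integrable_continuous_compact_support[OF _ K(1)],
        (intro continuous_intros; assumption), simp add: K)+
  ultimately show ?thesis by simp
qed

end

text \<open>Powers of the positive part provide cut-offs of just the smoothness required: the square
  is \<open>C\<^sup>1\<close>, which suffices for \<eta>, and the cube is \<open>C\<^sup>2\<close>,
  which suffices for the step.\<close>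

lemma DERIV_max_0_power:
  "((\<lambda>s::real. (max 0 s) ^ (n + 2)) has_real_derivative real (n + 2) * (max 0 s) ^ (n + 1)) (at s)"
proof -
  consider "s < 0" | "s > 0" | "s = 0" by linarith
  then show ?thesis
  proof cases
    case 1
    have "((\<lambda>s::real. 0) has_real_derivative 0) (at s)" by simp
    then have "((\<lambda>s::real. (max 0 s) ^ (n + 2)) has_real_derivative 0) (at s)"
      by (rule has_field_derivative_transform_within_open[of _ _ _ "{..<0}"]) (use 1 in auto)
    then show ?thesis using 1 by simp
  next
    case 2
    have "((\<lambda>s::real. s ^ (n + 2)) has_real_derivative real (n + 2) * s ^ (n + 1)) (at s)"
      using DERIV_pow[of "n + 2" s UNIV] by simp
    then have "((\<lambda>s::real. (max 0 s) ^ (n + 2)) has_real_derivative real (n + 2) * s ^ (n + 1)) (at s)"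
      by (rule has_field_derivative_transform_within_open[of _ _ _ "{0<..}"]) (use 2 in auto)
    then show ?thesis using 2 by simp
  next
    case 3
    have "((\<lambda>t::real. (max 0 t) ^ (n + 1)) \<longlongrightarrow> (max 0 0) ^ (n + 1)) (at 0)"
      by (intro tendsto_intros)
    moreover have "(max 0 t) ^ (n + 1) = (max 0 t) ^ (n + 2) / t" if "t \<noteq> 0" for t :: real
      using that by (auto simp: max_def)
    ultimately have "((\<lambda>t::real. (max 0 t) ^ (n + 2) / t) \<longlongrightarrow> 0) (at 0)"
      by (subst (asm) Lim_cong_within[OF refl refl refl]) (auto simp del: power_Suc)
    then show ?thesis using 3 by (simp add: DERIV_def)
  qed
qed

lemma DERIV_max_0_power2: "((\<lambda>s::real. (max 0 s)\<^sup>2) has_real_derivative 2 * max 0 s) (at s)"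
  using DERIV_max_0_power[of 0 s] by (simp add: numeral_2_eq_2)

lemma has_dir_deriv_norm_sq: "has_dir_deriv b (\<lambda>x. x \<bullet> x) (2 * (x \<bullet> b)) x"
proof -
  have "(\<lambda>t. (x + t *\<^sub>R b) \<bullet> (x + t *\<^sub>R b)) = (\<lambda>t. x \<bullet> x + 2 * t * (x \<bullet> b) + t\<^sup>2 * (b \<bullet> b))"
    by (simp add: fun_eq_iff algebra_simps inner_commute power2_eq_square)
  then show ?thesis
    unfolding has_dir_deriv_def by (auto intro!: derivative_eq_intros)
qed

section \<open>Caccioppoli inequality and finiteness of the potential energy\<close>

context eigenfunction
begin

lemma cutoff_integrable:
  fixes \<eta> f :: "'a \<Rightarrow> real"
  assumes K: "compact K" "\<And>x. x \<notin> K \<Longrightarrow> \<eta> x = 0" and "continuous_on UNIV \<eta>"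
    and [continuous_intros]: "continuous_on UNIV f"
  shows "integrable lborel (\<lambda>x. \<eta> x * f x)"
  by (rule integrable_continuous_compact_support[OF _ K(1)]) (auto intro!: continuous_intros assms simp: K)

text \<open>The hypothesis bounds the squared gradient of the cutoff by the cutoff itself, so the cross
  term can be absorbed by Young's inequality.\<close>

lemma caccioppoli:
  assumes d: "\<And>b x. b \<in> Basis \<Longrightarrow> has_dir_deriv b \<eta> (\<eta>' b x) x"
    and c: "continuous_on UNIV \<eta>" "\<And>b. b \<in> Basis \<Longrightarrow> continuous_on UNIV (\<eta>' b)"
    and K: "compact K" "\<And>x. x \<notin> K \<Longrightarrow> \<eta> x = 0" "\<And>b x. b \<in> Basis \<Longrightarrow> x \<notin> K \<Longrightarrow> \<eta>' b x = 0"
    and nonneg: "\<And>x. 0 \<le> \<eta> x" and grad_le: "\<And>x. (\<Sum>b\<in>Basis. (\<eta>' b x)\<^sup>2) \<le> \<kappa> * \<eta> x"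
    and w: "integrable lborel w" "\<And>x. 0 \<le> w x" "\<And>x. \<eta> x \<noteq> 0 \<Longrightarrow> \<kappa> * (\<psi> x)\<^sup>2 \<le> w x"
  shows "h\<^sup>2 / 2 * (\<integral>x. \<eta> x * G x \<partial>lborel) + (\<integral>x. (v x - E) * (\<eta> x * (\<psi> x)\<^sup>2) \<partial>lborel)
    \<le> h\<^sup>2 / 2 * (\<integral>x. w x \<partial>lborel)"
proof -
  note [continuous_intros] = c
  define S where "S x = (\<Sum>b\<in>Basis. \<eta>' b x * d\<psi> b x)" for x
  have iG: "integrable lborel (\<lambda>x. \<eta> x * G x)"
    by (intro cutoff_integrable[OF K(1,2)] c cont_G)
  have iS: "integrable lborel (\<lambda>x. \<psi> x * S x)"
    unfolding S_def
    by (rule integrable_continuous_compact_support[OF _ K(1)]) (auto intro!: continuous_intros simp: K)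
  have G0: "0 \<le> G x" for x unfolding G_def by (intro sum_nonneg) auto
  have pw: "- (\<psi> x * S x) \<le> (\<eta> x * G x + w x) / 2" for x
  proof (cases "\<eta> x = 0")
    \<comment> \<open>Where \<eta> vanishes, \<open>grad_le\<close> forces its derivatives to vanish
      too. This is why \<open>w\<close> has to dominate \<open>\<kappa> \<psi>\<^sup>2\<close> only
      where \<eta> is nonzero.\<close>
    case True
    then have "(\<Sum>b\<in>Basis. (\<eta>' b x)\<^sup>2) = 0"
      using grad_le[of x] by (intro antisym sum_nonneg) auto
    then have "\<forall>b\<in>Basis. \<eta>' b x = 0" by (subst (asm) sum_nonneg_eq_0_iff) auto
    then show ?thesis using True w(2)[of x] by (simp add: S_def)
  next
    case False
    have "(S x)\<^sup>2 \<le> (\<Sum>b\<in>Basis. (\<eta>' b x)\<^sup>2) * G x"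
      unfolding S_def G_def by (rule Cauchy_Schwarz_ineq_sum)
    also have "\<dots> \<le> \<kappa> * \<eta> x * G x"
      by (rule mult_right_mono[OF grad_le G0])
    finally have "(\<psi> x)\<^sup>2 * (S x)\<^sup>2 \<le> (\<psi> x)\<^sup>2 * (\<kappa> * \<eta> x * G x)"
      by (intro mult_left_mono) auto
    also have "\<dots> = (\<kappa> * (\<psi> x)\<^sup>2) * (\<eta> x * G x)" by simp
    also have "\<dots> \<le> w x * (\<eta> x * G x)"
      by (intro mult_right_mono w(3) False mult_nonneg_nonneg nonneg G0)
    also have "\<dots> \<le> ((\<eta> x * G x + w x) / 2)\<^sup>2"
      using zero_le_power2[of "\<eta> x * G x - w x"] by (simp add: power2_eq_square field_simps)
    finally have "(\<psi> x * S x)\<^sup>2 \<le> ((\<eta> x * G x + w x) / 2)\<^sup>2" by (simp add: power_mult_distrib)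
    then have "\<bar>\<psi> x * S x\<bar> \<le> \<bar>(\<eta> x * G x + w x) / 2\<bar>"
      by (rule abs_le_square_iff[THEN iffD2])
    moreover have "0 \<le> (\<eta> x * G x + w x) / 2" using nonneg[of x] G0[of x] w(2)[of x] by simp
    ultimately show ?thesis by linarith
  qed
  have "(\<integral>x. - (\<psi> x * S x) \<partial>lborel) \<le> (\<integral>x. (\<eta> x * G x + w x) / 2 \<partial>lborel)"
    using iG iS w(1) pw by (intro Bochner_Integration.integral_mono) auto
  then have "- (\<integral>x. \<psi> x * S x \<partial>lborel) \<le> (\<integral>x. \<eta> x * G x \<partial>lborel) / 2 + (\<integral>x. w x \<partial>lborel) / 2"
    using iG w(1) by (simp add: add_divide_distrib)
  then have "h\<^sup>2 * - (\<integral>x. \<psi> x * S x \<partial>lborel)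
      \<le> h\<^sup>2 * ((\<integral>x. \<eta> x * G x \<partial>lborel) / 2 + (\<integral>x. w x \<partial>lborel) / 2)"
    by (rule mult_left_mono) simp
  moreover note energy_identity[OF d c K]
  ultimately show ?thesis unfolding S_def by (simp add: algebra_simps)
qed

text \<open>The Caccioppoli inequality for a radial bump whose squared gradient is at most
  \<open>16 / R\<^sup>2\<close> times the bump. With the weight
  \<open>16 / R\<^sup>2 * \<psi>\<^sup>2\<close> and the normalization, the right-hand side is
  \<open>h\<^sup>2 / 2 * 16 / R\<^sup>2\<close>; the gradient integral is dropped by sign.\<close>

lemma truncated_energy:
  fixes R :: real
  defines "\<eta> \<equiv> \<lambda>x::'a. (max 0 (1 - inverse (R\<^sup>2) * (x \<bullet> x)))\<^sup>2"
  assumes R: "R \<ge> 1"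
  shows "integrable lborel (\<lambda>x. v x * (\<eta> x * (\<psi> x)\<^sup>2))"
    and "(\<integral>x. v x * (\<eta> x * (\<psi> x)\<^sup>2) \<partial>lborel) \<le> E * (\<integral>x. \<eta> x * (\<psi> x)\<^sup>2 \<partial>lborel) + 8 * h\<^sup>2 / R\<^sup>2"
proof -
  define m where "m x = max 0 (1 - inverse (R\<^sup>2) * (x \<bullet> x))" for x :: 'a
  define \<eta>' where "\<eta>' b x = (2 * m x) * (0 - inverse (R\<^sup>2) * (2 * (x \<bullet> b)))" for b x
  have \<eta>: "\<eta> x = (m x)\<^sup>2" for x by (simp add: \<eta>_def m_def)
  have m0: "m x = 0" if "x \<notin> cball 0 R" for x
  proof -
    have "norm x > R" using that by simp
    then have "R\<^sup>2 \<le> x \<bullet> x" using R by (simp add: power2_norm_eq_inner[symmetric] power_mono)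
    then show ?thesis using R by (simp add: m_def field_simps)
  qed
  have d: "has_dir_deriv b \<eta> (\<eta>' b x) x" for b x
    unfolding \<eta>_def \<eta>'_def m_def
    by (intro has_dir_deriv_chain[where k = "\<lambda>s. (max 0 s)\<^sup>2"] DERIV_max_0_power2 has_dir_deriv_diff
        has_dir_deriv_const has_dir_deriv_cmult has_dir_deriv_norm_sq)
  have c: "continuous_on UNIV \<eta>" "continuous_on UNIV (\<eta>' b)" for b
    unfolding \<eta>_def \<eta>'_def m_def by (intro continuous_intros)+
  have K: "compact (cball 0 R :: 'a set)" "x \<notin> cball 0 R \<Longrightarrow> \<eta> x = 0"
      "x \<notin> cball 0 R \<Longrightarrow> \<eta>' b x = 0" for b x
    using m0 by (simp_all add: \<eta> \<eta>'_def)
  have gr: "(\<Sum>b\<in>Basis. (\<eta>' b x)\<^sup>2) \<le> 16 / R\<^sup>2 * \<eta> x" for x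
  proof -
    have "(\<Sum>b\<in>Basis. (\<eta>' b x)\<^sup>2) = (\<Sum>b\<in>Basis. 16 * (m x)\<^sup>2 / (R\<^sup>2)\<^sup>2 * ((x \<bullet> b) * (x \<bullet> b)))"
      by (intro sum.cong refl) (simp add: \<eta>'_def power2_eq_square field_simps)
    also have "\<dots> = 16 * (m x)\<^sup>2 / (R\<^sup>2)\<^sup>2 * (x \<bullet> x)"
      by (simp only: sum_distrib_left[symmetric] euclidean_inner[of x x])
    also have "\<dots> \<le> 16 * (m x)\<^sup>2 / (R\<^sup>2)\<^sup>2 * R\<^sup>2"
    proof (cases "x \<in> cball 0 R")
      case True
      then have "x \<bullet> x \<le> R\<^sup>2" by (simp add: power2_norm_eq_inner[symmetric] power_mono)
      then show ?thesis by (intro mult_left_mono) auto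
    qed (simp add: m0)
    also have "\<dots> = 16 / R\<^sup>2 * \<eta> x" using R by (simp add: \<eta> power2_eq_square)
    finally show ?thesis .
  qed
  have ca: "h\<^sup>2 / 2 * (\<integral>x. \<eta> x * G x \<partial>lborel) + (\<integral>x. (v x - E) * (\<eta> x * (\<psi> x)\<^sup>2) \<partial>lborel)
      \<le> h\<^sup>2 / 2 * (\<integral>x. 16 / R\<^sup>2 * (\<psi> x)\<^sup>2 \<partial>lborel)"
    by (rule caccioppoli[OF d c K _ gr]) (auto simp: \<eta> integrable_sq)
  have "0 \<le> (\<integral>x. \<eta> x * G x \<partial>lborel)"
    by (intro Bochner_Integration.integral_nonneg) (auto simp: \<eta> G_def intro!: mult_nonneg_nonneg sum_nonneg)
  then have "0 \<le> h\<^sup>2 / 2 * (\<integral>x. \<eta> x * G x \<partial>lborel)" by simp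
  with ca have le: "(\<integral>x. (v x - E) * (\<eta> x * (\<psi> x)\<^sup>2) \<partial>lborel) \<le> 8 * h\<^sup>2 / R\<^sup>2"
    using integral_sq by simp
  have i1: "integrable lborel (\<lambda>x. \<eta> x * (v x * (\<psi> x)\<^sup>2))"
    by (intro cutoff_integrable[OF K(1,2)] c continuous_intros)
  then show iv: "integrable lborel (\<lambda>x. v x * (\<eta> x * (\<psi> x)\<^sup>2))" by (simp add: mult_ac)
  have "integrable lborel (\<lambda>x. \<eta> x * (\<psi> x)\<^sup>2)"
    by (intro cutoff_integrable[OF K(1,2)] c continuous_intros)
  with iv le show "(\<integral>x. v x * (\<eta> x * (\<psi> x)\<^sup>2) \<partial>lborel)
      \<le> E * (\<integral>x. \<eta> x * (\<psi> x)\<^sup>2 \<partial>lborel) + 8 * h\<^sup>2 / R\<^sup>2"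
    by (simp add: left_diff_distrib)
qed

text \<open>Both facts follow by removing the truncation: the limit of
  \<open>truncated_energy\<close> gives \<open>0 \<le> E\<close>, and then the truncated potential
  energies are bounded uniformly, so Fatou's lemma applies. Integrability is not part of
  \<open>normalized_eigenfunction\<close>, and without it the integral in
  \<open>potential_energy\<close> would take the default value 0.\<close>

lemma eigenvalue_nonneg: "0 \<le> E"
  and integrable_potential: "integrable lborel (\<lambda>x. v x * (\<psi> x)\<^sup>2)"
proof -
  define \<eta> where "\<eta> n x = (max 0 (1 - inverse ((real (Suc n))\<^sup>2) * (x \<bullet> x)))\<^sup>2" for n and x :: 'a
  have \<eta>1: "0 \<le> \<eta> n x" "\<eta> n x \<le> 1" for n x
    unfolding \<eta>_def by (auto intro!: power_le_one)
  have iv: "integrable lborel (\<lambda>x. v x * (\<eta> n x * (\<psi> x)\<^sup>2))" for n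
    unfolding \<eta>_def by (rule truncated_energy) simp
  have le: "(\<integral>x. v x * (\<eta> n x * (\<psi> x)\<^sup>2) \<partial>lborel)
      \<le> E * (\<integral>x. \<eta> n x * (\<psi> x)\<^sup>2 \<partial>lborel) + 8 * h\<^sup>2 / (real (Suc n))\<^sup>2" for n
    unfolding \<eta>_def by (rule truncated_energy) simp
  have R0: "(\<lambda>n. inverse ((real (Suc n))\<^sup>2)) \<longlonglongrightarrow> 0"
    using tendsto_power[OF LIMSEQ_inverse_real_of_nat, of 2] by (simp add: power_inverse)
  have \<eta>_lim: "(\<lambda>n. \<eta> n x) \<longlonglongrightarrow> 1" for x
  proof -
    have "(\<lambda>n. \<eta> n x) \<longlonglongrightarrow> (max 0 (1 - 0 * (x \<bullet> x)))\<^sup>2"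
      unfolding \<eta>_def by (intro tendsto_intros R0)
    then show ?thesis by simp
  qed
  have meas [measurable]: "\<eta> n \<in> borel_measurable borel" "v \<in> borel_measurable borel"
      "\<psi> \<in> borel_measurable borel" for n
    unfolding \<eta>_def by (intro borel_measurable_continuous_onI continuous_intros)+
  have le1: "(\<integral>x. \<eta> n x * (\<psi> x)\<^sup>2 \<partial>lborel) \<le> 1" "0 \<le> (\<integral>x. \<eta> n x * (\<psi> x)\<^sup>2 \<partial>lborel)" for n
  proof -
    have "integrable lborel (\<lambda>x. \<eta> n x * (\<psi> x)\<^sup>2)"
      by (rule Bochner_Integration.integrable_bound[OF integrable_sq]) (auto simp: abs_mult \<eta>1 intro!: mult_left_le_one_le)
    then have "(\<integral>x. \<eta> n x * (\<psi> x)\<^sup>2 \<partial>lborel) \<le> (\<integral>x. (\<psi> x)\<^sup>2 \<partial>lborel)"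
      by (intro Bochner_Integration.integral_mono integrable_sq) (auto simp: \<eta>1 intro!: mult_left_le_one_le)
    then show "(\<integral>x. \<eta> n x * (\<psi> x)\<^sup>2 \<partial>lborel) \<le> 1" using integral_sq by simp
    show "0 \<le> (\<integral>x. \<eta> n x * (\<psi> x)\<^sup>2 \<partial>lborel)" by (intro Bochner_Integration.integral_nonneg) (auto simp: \<eta>1)
  qed
  have lim1: "(\<lambda>n. \<integral>x. \<eta> n x * (\<psi> x)\<^sup>2 \<partial>lborel) \<longlonglongrightarrow> (\<integral>x. (\<psi> x)\<^sup>2 \<partial>lborel)"
  proof (rule integral_dominated_convergence[OF _ _ integrable_sq])
    show "AE x in lborel. (\<lambda>n. \<eta> n x * (\<psi> x)\<^sup>2) \<longlonglongrightarrow> (\<psi> x)\<^sup>2"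
      using tendsto_mult[OF \<eta>_lim tendsto_const] by simp
    show "AE x in lborel. norm (\<eta> n x * (\<psi> x)\<^sup>2) \<le> (\<psi> x)\<^sup>2" for n
      by (auto simp: abs_mult \<eta>1 intro!: mult_left_le_one_le)
  qed auto
  have "(\<lambda>n. E * (\<integral>x. \<eta> n x * (\<psi> x)\<^sup>2 \<partial>lborel) + 8 * h\<^sup>2 * inverse ((real (Suc n))\<^sup>2))
      \<longlonglongrightarrow> E * 1 + 8 * h\<^sup>2 * 0"
    by (intro tendsto_intros R0 lim1[unfolded integral_sq])
  moreover have "0 \<le> E * (\<integral>x. \<eta> n x * (\<psi> x)\<^sup>2 \<partial>lborel) + 8 * h\<^sup>2 * inverse ((real (Suc n))\<^sup>2)" for n
  proof -
    have "0 \<le> (\<integral>x. v x * (\<eta> n x * (\<psi> x)\<^sup>2) \<partial>lborel)"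
      by (intro Bochner_Integration.integral_nonneg) (auto simp: \<eta>1 v_nonneg)
    with le[of n] show ?thesis by (simp add: divide_inverse)
  qed
  ultimately show E0: "0 \<le> E"
    using LIMSEQ_le_const[of _ "E * 1 + 8 * h\<^sup>2 * 0" 0] by auto
  have le2: "(\<integral>\<^sup>+x. ennreal (v x * (\<eta> n x * (\<psi> x)\<^sup>2)) \<partial>lborel) \<le> ennreal (E + 8 * h\<^sup>2)" for n
  proof -
    have "E * (\<integral>x. \<eta> n x * (\<psi> x)\<^sup>2 \<partial>lborel) \<le> E"
      using E0 le1[of n] by (simp add: mult_left_le)
    moreover have "8 * h\<^sup>2 / (real (Suc n))\<^sup>2 \<le> 8 * h\<^sup>2"
    proof -
      have "8 * h\<^sup>2 / (real (Suc n))\<^sup>2 \<le> 8 * h\<^sup>2 / 1"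
        by (intro divide_left_mono) (auto simp: one_le_power)
      then show ?thesis by simp
    qed
    ultimately have "(\<integral>x. v x * (\<eta> n x * (\<psi> x)\<^sup>2) \<partial>lborel) \<le> E + 8 * h\<^sup>2" using le[of n] by linarith
    then show ?thesis
      by (subst nn_integral_eq_integral[OF iv]) (auto simp: \<eta>1 v_nonneg intro!: ennreal_leI)
  qed
  have "(\<integral>\<^sup>+x. ennreal (v x * (\<psi> x)\<^sup>2) \<partial>lborel)
      = (\<integral>\<^sup>+x. liminf (\<lambda>n. ennreal (v x * (\<eta> n x * (\<psi> x)\<^sup>2))) \<partial>lborel)"
  proof (intro nn_integral_cong)
    fix x
    have "(\<lambda>n. ennreal (v x * (\<eta> n x * (\<psi> x)\<^sup>2))) \<longlonglongrightarrow> ennreal (v x * (1 * (\<psi> x)\<^sup>2))"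
      by (intro tendsto_ennrealI tendsto_intros \<eta>_lim)
    then show "ennreal (v x * (\<psi> x)\<^sup>2) = liminf (\<lambda>n. ennreal (v x * (\<eta> n x * (\<psi> x)\<^sup>2)))"
      by (simp add: lim_imp_Liminf)
  qed
  also have "\<dots> \<le> liminf (\<lambda>n. \<integral>\<^sup>+x. ennreal (v x * (\<eta> n x * (\<psi> x)\<^sup>2)) \<partial>lborel)"
    by (rule nn_integral_liminf) measurable
  also have "\<dots> \<le> liminf (\<lambda>n::nat. ennreal (E + 8 * h\<^sup>2))"
    by (intro Liminf_mono always_eventually allI le2)
  also have "\<dots> < \<infinity>" by (simp add: Liminf_const)
  finally show "integrable lborel (\<lambda>x. v x * (\<psi> x)\<^sup>2)"
    by (intro integrableI_nonneg) (auto simp: v_nonneg)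
qed

end

section \<open>The virial bound\<close>

text \<open>
  \<open>X\<close> is a compactly supported vector field whose derivative is \<open>F\<close> times the identity plus the
  remainder \<open>Z\<close>, and \<open>g'\<close> is the gradient of its divergence.  The bump \<open>\<eta>\<close> lives in the region \<open>v \<ge> a\<close>
  and dominates everything that vanishes where \<open>F\<close> is locally constant.
\<close>

locale virial_multiplier =
  fixes v :: "'a::euclidean_space \<Rightarrow> real" and a c\<^sub>1 :: real
    and F :: "'a \<Rightarrow> real" and F' :: "'a \<Rightarrow> 'a \<Rightarrow> real"
    and X :: "'a \<Rightarrow> 'a \<Rightarrow> real" and Z :: "'a \<Rightarrow> 'a \<Rightarrow> 'a \<Rightarrow> real" and g' :: "'a \<Rightarrow> 'a \<Rightarrow> real"
    and \<eta> :: "'a \<Rightarrow> real" and \<eta>' :: "'a \<Rightarrow> 'a \<Rightarrow> real"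
    and K :: "'a set" and B \<kappa> M :: real
  assumes dF: "\<And>b x. b \<in> Basis \<Longrightarrow> has_dir_deriv b F (F' b x) x"
    and dX: "\<And>j b x. j \<in> Basis \<Longrightarrow> b \<in> Basis \<Longrightarrow> has_dir_deriv b (X j) (F x * (b \<bullet> j) + Z j b x) x"
    and dg: "\<And>b x. b \<in> Basis
      \<Longrightarrow> has_dir_deriv b (\<lambda>x. \<Sum>b\<in>Basis. F x * (b \<bullet> b) + Z b b x) (g' b x) x"
    and d\<eta>: "\<And>b x. b \<in> Basis \<Longrightarrow> has_dir_deriv b \<eta> (\<eta>' b x) x"
    and cont: "continuous_on UNIV F" "\<And>b. b \<in> Basis \<Longrightarrow> continuous_on UNIV (F' b)"
      "\<And>j. j \<in> Basis \<Longrightarrow> continuous_on UNIV (X j)"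
      "\<And>j b. j \<in> Basis \<Longrightarrow> b \<in> Basis \<Longrightarrow> continuous_on UNIV (Z j b)"
      "\<And>b. b \<in> Basis \<Longrightarrow> continuous_on UNIV (g' b)"
      "continuous_on UNIV \<eta>" "\<And>b. b \<in> Basis \<Longrightarrow> continuous_on UNIV (\<eta>' b)"
    and compact_K: "compact K"
    and supp: "\<And>x. x \<notin> K \<Longrightarrow> F x = 0" "\<And>j x. x \<notin> K \<Longrightarrow> X j x = 0" "\<And>x. x \<notin> K \<Longrightarrow> \<eta> x = 0"
      "\<And>b x. x \<notin> K \<Longrightarrow> \<eta>' b x = 0"
    and F_bounds: "\<And>x. 0 \<le> F x" "\<And>x. F x \<le> 1" "\<And>x. F x \<noteq> 1 \<Longrightarrow> a \<le> v x"
    and X_le: "\<And>x. (\<Sum>b\<in>Basis. X b x * partial_deriv b v x) \<le> c\<^sub>1 * v x"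
    and \<eta>_dominates: "\<And>b x. b \<in> Basis \<Longrightarrow> \<bar>F' b x\<bar> \<le> B * \<eta> x"
      "\<And>j b x. j \<in> Basis \<Longrightarrow> b \<in> Basis \<Longrightarrow> \<bar>Z j b x\<bar> \<le> B * \<eta> x"
      "\<And>b x. b \<in> Basis \<Longrightarrow> \<bar>g' b x\<bar> \<le> B * \<eta> x"
    and \<eta>_bounds: "\<And>x. 0 \<le> \<eta> x" "\<And>x. \<eta> x \<le> M" "\<And>x. \<eta> x \<noteq> 0 \<Longrightarrow> a \<le> v x"
      "\<And>x. (\<Sum>b\<in>Basis. (\<eta>' b x)\<^sup>2) \<le> \<kappa> * \<eta> x"
    and pos: "0 < a" "0 \<le> B" "0 \<le> \<kappa>"

text \<open>\<open>E_le\<close> makes \<open>v - E\<close> nonnegative both where \<open>F\<close>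
  differs from 1 and where \<eta> is nonzero, which fixes the sign of the potential terms
  there.\<close>

locale eigenfunction_virial = eigenfunction v h E \<psi> + virial_multiplier v a c\<^sub>1 F F' X Z g' \<eta> \<eta>' K B \<kappa> M
  for v :: "'a::euclidean_space \<Rightarrow> real" and h E \<psi> a c\<^sub>1 F F' X Z g' \<eta> \<eta>' K B \<kappa> M +
  assumes E_le: "E \<le> a"
begin

abbreviation "U \<equiv> potential_energy v \<psi>"

lemma supp': "b \<in> Basis \<Longrightarrow> x \<notin> K \<Longrightarrow> F' b x = 0"
  "j \<in> Basis \<Longrightarrow> b \<in> Basis \<Longrightarrow> x \<notin> K \<Longrightarrow> Z j b x = 0"
  "b \<in> Basis \<Longrightarrow> x \<notin> K \<Longrightarrow> g' b x = 0"
  using \<eta>_dominates(1)[of b x] \<eta>_dominates(2)[of j b x] \<eta>_dominates(3)[of b x] supp(3)[of x]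
  by simp_all

lemma integrable_\<eta>: "integrable lborel (\<lambda>x. \<eta> x * G x)" "integrable lborel (\<lambda>x. \<eta> x * (\<psi> x)\<^sup>2)"
  "integrable lborel (\<lambda>x. F x * G x)" "integrable lborel (\<lambda>x. F x * ((v x - E) * (\<psi> x)\<^sup>2))"
  by (intro cutoff_integrable[OF compact_K supp(3)] cutoff_integrable[OF compact_K supp(1)]
      cont continuous_intros; assumption)+

text \<open>Where \<eta> is nonzero, \<open>\<psi>\<^sup>2 \<le> v \<psi>\<^sup>2 / a\<close>, so
  the Caccioppoli weight can be chosen as a multiple of the density of \<open>U\<close>. The
  potential term is nonnegative and is dropped; the factor \<open>h\<^sup>2 / 2\<close> then
  cancels, so the bound does not depend on \<open>h\<close>.\<close>

lemma gradient_mass_le: "a * (\<integral>x. \<eta> x * G x \<partial>lborel) \<le> \<kappa> * U"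
proof -
  have i: "integrable lborel (\<lambda>x. \<kappa> / a * (v x * (\<psi> x)\<^sup>2))"
    using integrable_potential by simp
  have w: "(\<integral>x. \<kappa> / a * (v x * (\<psi> x)\<^sup>2) \<partial>lborel) = \<kappa> / a * U"
    unfolding potential_energy_def by (rule integral_mult_right_zero)
  have "h\<^sup>2 / 2 * (\<integral>x. \<eta> x * G x \<partial>lborel) + (\<integral>x. (v x - E) * (\<eta> x * (\<psi> x)\<^sup>2) \<partial>lborel)
      \<le> h\<^sup>2 / 2 * (\<integral>x. \<kappa> / a * (v x * (\<psi> x)\<^sup>2) \<partial>lborel)"
  proof (rule caccioppoli[OF d\<eta> cont(6,7) compact_K supp(3,4) \<eta>_bounds(1,4) i])
    show "0 \<le> \<kappa> / a * (v x * (\<psi> x)\<^sup>2)" for x using pos v_nonneg by simp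
    show "\<kappa> * (\<psi> x)\<^sup>2 \<le> \<kappa> / a * (v x * (\<psi> x)\<^sup>2)" if "\<eta> x \<noteq> 0" for x
    proof -
      have "\<kappa> / a * (a * (\<psi> x)\<^sup>2) \<le> \<kappa> / a * (v x * (\<psi> x)\<^sup>2)"
        using \<eta>_bounds(3)[OF that] pos by (intro mult_left_mono mult_right_mono) auto
      then show ?thesis using pos by simp
    qed
  qed
  moreover have "0 \<le> (\<integral>x. (v x - E) * (\<eta> x * (\<psi> x)\<^sup>2) \<partial>lborel)"
  proof (intro Bochner_Integration.integral_nonneg)
    show "0 \<le> (v x - E) * (\<eta> x * (\<psi> x)\<^sup>2)" for x
      using \<eta>_bounds(1)[of x] \<eta>_bounds(3)[of x] E_le by (cases "\<eta> x = 0") auto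
  qed
  ultimately have "h\<^sup>2 / 2 * (\<integral>x. \<eta> x * G x \<partial>lborel) \<le> h\<^sup>2 / 2 * (\<kappa> / a * U)"
    unfolding w by linarith
  then have "(\<integral>x. \<eta> x * G x \<partial>lborel) \<le> \<kappa> / a * U"
    using h_pos by (simp only: mult_le_cancel_left_pos[of "h\<^sup>2 / 2"] half_gt_zero zero_less_power)
  then show ?thesis using pos by (simp add: field_simps)
qed

lemma mass_le: "a * (\<integral>x. \<eta> x * (\<psi> x)\<^sup>2 \<partial>lborel) \<le> M * U"
proof -
  have "(\<integral>x. a * (\<eta> x * (\<psi> x)\<^sup>2) \<partial>lborel) \<le> (\<integral>x. M * (v x * (\<psi> x)\<^sup>2) \<partial>lborel)"
  proof (intro Bochner_Integration.integral_mono)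
    show "a * (\<eta> x * (\<psi> x)\<^sup>2) \<le> M * (v x * (\<psi> x)\<^sup>2)" for x
    proof -
      have "a * \<eta> x \<le> v x * M"
      proof (cases "\<eta> x = 0")
        case True
        then show ?thesis using \<eta>_bounds(2)[of x] v_nonneg[of x] by simp
      next
        case False
        then show ?thesis
          using \<eta>_bounds(1-3)[of x] pos v_nonneg[of x] by (intro mult_mono) auto
      qed
      then have "a * \<eta> x * (\<psi> x)\<^sup>2 \<le> v x * M * (\<psi> x)\<^sup>2" by (rule mult_right_mono) simp
      then show ?thesis by (simp add: mult_ac)
    qed
  qed (use integrable_\<eta> integrable_potential in auto)
  then show ?thesis by (simp add: potential_energy_def)
qed

text \<open>Young's inequality coordinate by coordinate. The square of \<psi> appears once for every
  basis vector, hence the factor \<open>DIM('a)\<close>.\<close>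

lemma cross_term_le:
  assumes c: "\<And>b. b \<in> Basis \<Longrightarrow> continuous_on UNIV (k b)"
    and k: "\<And>b x. b \<in> Basis \<Longrightarrow> \<bar>k b x\<bar> \<le> B * \<eta> x"
  shows "\<bar>\<integral>x. \<psi> x * (\<Sum>b\<in>Basis. k b x * d\<psi> b x) \<partial>lborel\<bar>
    \<le> B / 2 * (real DIM('a) * (\<integral>x. \<eta> x * (\<psi> x)\<^sup>2 \<partial>lborel) + (\<integral>x. \<eta> x * G x \<partial>lborel))"
proof -
  have pw: "\<bar>\<psi> x * (\<Sum>b\<in>Basis. k b x * d\<psi> b x)\<bar>
      \<le> B / 2 * (real DIM('a) * (\<eta> x * (\<psi> x)\<^sup>2) + \<eta> x * G x)" for x
  proof -
    have "\<bar>\<psi> x * (\<Sum>b\<in>Basis. k b x * d\<psi> b x)\<bar> \<le> (\<Sum>b\<in>Basis. \<bar>\<psi> x * (k b x * d\<psi> b x)\<bar>)"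
      unfolding sum_distrib_left by (rule sum_abs)
    also have "\<dots> \<le> (\<Sum>b\<in>Basis. B / 2 * \<eta> x * ((\<psi> x)\<^sup>2 + (d\<psi> b x)\<^sup>2))"
    proof (rule sum_mono)
      fix b :: 'a assume b: "b \<in> Basis"
      have "2 * \<bar>\<psi> x * d\<psi> b x\<bar> \<le> (\<psi> x)\<^sup>2 + (d\<psi> b x)\<^sup>2"
        using sum_squares_bound[of "\<bar>\<psi> x\<bar>" "\<bar>d\<psi> b x\<bar>"] by (simp add: abs_mult)
      then have "\<bar>k b x\<bar> * (2 * \<bar>\<psi> x * d\<psi> b x\<bar>) \<le> B * \<eta> x * ((\<psi> x)\<^sup>2 + (d\<psi> b x)\<^sup>2)"
        using k[OF b, of x] pos \<eta>_bounds(1)[of x] by (intro mult_mono) auto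
      then show "\<bar>\<psi> x * (k b x * d\<psi> b x)\<bar> \<le> B / 2 * \<eta> x * ((\<psi> x)\<^sup>2 + (d\<psi> b x)\<^sup>2)"
        by (simp add: abs_mult mult_ac)
    qed
    also have "\<dots> = B / 2 * (real DIM('a) * (\<eta> x * (\<psi> x)\<^sup>2) + \<eta> x * G x)"
      by (simp only: sum_distrib_left[symmetric] sum.distrib G_def) (simp add: algebra_simps)
    finally show ?thesis .
  qed
  have z: "k b x = 0" if "b \<in> Basis" "x \<notin> K" for b x
    using k[of b x] supp(3)[of x] that by simp
  have i: "integrable lborel (\<lambda>x. \<psi> x * (\<Sum>b\<in>Basis. k b x * d\<psi> b x))"
    by (rule integrable_continuous_compact_support[OF _ compact_K])
       (auto intro!: continuous_intros c simp: z)
  have "\<bar>\<integral>x. \<psi> x * (\<Sum>b\<in>Basis. k b x * d\<psi> b x) \<partial>lborel\<bar>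
      \<le> (\<integral>x. \<bar>\<psi> x * (\<Sum>b\<in>Basis. k b x * d\<psi> b x)\<bar> \<partial>lborel)"
    by (rule integral_abs_bound)
  also have "\<dots> \<le> (\<integral>x. B / 2 * (real DIM('a) * (\<eta> x * (\<psi> x)\<^sup>2) + \<eta> x * G x) \<partial>lborel)"
    using i integrable_\<eta> pw by (intro Bochner_Integration.integral_mono) auto
  also have "\<dots> = B / 2 * (real DIM('a) * (\<integral>x. \<eta> x * (\<psi> x)\<^sup>2 \<partial>lborel) + (\<integral>x. \<eta> x * G x \<partial>lborel))"
    using integrable_\<eta> by simp
  finally show ?thesis .
qed

text \<open>Young's inequality again; in the double sum every squared derivative of \<psi> occurs
  \<open>DIM('a)\<close> times from each of the two factors. Only this one-sided bound is needed,
  because the term has to be bounded below in the virial identity.\<close>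

lemma Z_sum_le:
  "- (\<Sum>b\<in>Basis. \<Sum>j\<in>Basis. Z j b x * d\<psi> j x * d\<psi> b x) \<le> B * real DIM('a) * (\<eta> x * G x)"
proof -
  have "- (\<Sum>b\<in>Basis. \<Sum>j\<in>Basis. Z j b x * d\<psi> j x * d\<psi> b x)
      = (\<Sum>b\<in>Basis. \<Sum>j\<in>Basis. - (Z j b x * d\<psi> j x * d\<psi> b x))"
    by (simp add: sum_negf)
  also have "\<dots> \<le> (\<Sum>b\<in>Basis. \<Sum>j\<in>Basis. B / 2 * \<eta> x * ((d\<psi> j x)\<^sup>2 + (d\<psi> b x)\<^sup>2))"
  proof (intro sum_mono)
    fix b j :: 'a assume b: "b \<in> Basis" "j \<in> Basis"
    have "2 * \<bar>d\<psi> j x * d\<psi> b x\<bar> \<le> (d\<psi> j x)\<^sup>2 + (d\<psi> b x)\<^sup>2"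
      using sum_squares_bound[of "\<bar>d\<psi> j x\<bar>" "\<bar>d\<psi> b x\<bar>"] by (simp add: abs_mult)
    then have "\<bar>Z j b x\<bar> * (2 * \<bar>d\<psi> j x * d\<psi> b x\<bar>) \<le> B * \<eta> x * ((d\<psi> j x)\<^sup>2 + (d\<psi> b x)\<^sup>2)"
      using \<eta>_dominates(2)[OF b(2,1), of x] pos \<eta>_bounds(1)[of x] by (intro mult_mono) auto
    moreover have "- (Z j b x * d\<psi> j x * d\<psi> b x) \<le> \<bar>Z j b x\<bar> * \<bar>d\<psi> j x * d\<psi> b x\<bar>"
      by (metis abs_ge_minus_self abs_mult mult.assoc)
    ultimately show "- (Z j b x * d\<psi> j x * d\<psi> b x) \<le> B / 2 * \<eta> x * ((d\<psi> j x)\<^sup>2 + (d\<psi> b x)\<^sup>2)"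
      by simp
  qed
  also have "\<dots> = B / 2 * \<eta> x * (\<Sum>b\<in>Basis. \<Sum>j\<in>Basis. (d\<psi> j x)\<^sup>2 + (d\<psi> b x)\<^sup>2)"
    by (simp only: sum_distrib_left)
  also have "(\<Sum>b\<in>Basis. \<Sum>j\<in>Basis. (d\<psi> j x)\<^sup>2 + (d\<psi> b x)\<^sup>2) = 2 * real DIM('a) * G x"
    by (simp add: sum.distrib G_def sum_distrib_left[symmetric])
  also have "B / 2 * \<eta> x * (2 * real DIM('a) * G x) = B * real DIM('a) * (\<eta> x * G x)"
    by simp
  finally show ?thesis .
qed

text \<open>The cut-off kinetic energy \<open>T\<close> is eliminated: the virial identity bounds
  \<open>2 h\<^sup>2 T\<close> by \<open>c\<^sub>1 U\<close> plus errors, and the energy identity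
  weighted by \<open>F\<close> bounds \<open>E - U\<close> by \<open>h\<^sup>2 T\<close> plus an
  error. All errors are multiples of \<open>h\<^sup>2 U\<close> by the mass bounds for
  \<open>J\<close> and \<open>Q\<close>.\<close>

lemma virial_bound:
  "2 * E \<le> (2 + c\<^sub>1 + h\<^sup>2 * (B * (2 * real DIM('a) * \<kappa> + 3 / 2 * (real DIM('a) * M + \<kappa>)) / a)) * U"
proof -
  let ?d = "real DIM('a)"
  define J where "J = (\<integral>x. \<eta> x * G x \<partial>lborel)"
  define Q where "Q = (\<integral>x. \<eta> x * (\<psi> x)\<^sup>2 \<partial>lborel)"
  define T where "T = (\<integral>x. F x * G x \<partial>lborel)"
  define I1 where "I1 = (\<integral>x. \<psi> x * (\<Sum>b\<in>Basis. F' b x * d\<psi> b x) \<partial>lborel)"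
  define I2 where "I2 = (\<integral>x. \<psi> x * (\<Sum>b\<in>Basis. g' b x * d\<psi> b x) \<partial>lborel)"
  define I3 where "I3 = (\<integral>x. (\<Sum>b\<in>Basis. \<Sum>j\<in>Basis. Z j b x * d\<psi> j x * d\<psi> b x) \<partial>lborel)"
  have JQ: "a * J \<le> \<kappa> * U" "a * Q \<le> M * U"
    using gradient_mass_le mass_le by (simp_all add: J_def Q_def)
  have I12: "I1 \<le> B / 2 * (?d * Q + J)" "- I2 \<le> B / 2 * (?d * Q + J)"
    using cross_term_le[of F', OF cont(2) \<eta>_dominates(1)] cross_term_le[of g', OF cont(5) \<eta>_dominates(3)]
    unfolding I1_def I2_def J_def Q_def by linarith+
  have iZ: "integrable lborel (\<lambda>x. \<Sum>b\<in>Basis. \<Sum>j\<in>Basis. Z j b x * d\<psi> j x * d\<psi> b x)"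
    by (rule integrable_continuous_compact_support[OF _ compact_K])
       (auto intro!: continuous_intros cont simp: supp')
  have "(\<integral>x. - (\<Sum>b\<in>Basis. \<Sum>j\<in>Basis. Z j b x * d\<psi> j x * d\<psi> b x) \<partial>lborel)
      \<le> (\<integral>x. B * ?d * (\<eta> x * G x) \<partial>lborel)"
    using iZ integrable_\<eta> Z_sum_le by (intro Bochner_Integration.integral_mono) auto
  then have I3: "- I3 \<le> B * ?d * J"
    using iZ by (simp add: I3_def J_def)
  have Fsum: "(\<Sum>b\<in>Basis. \<Sum>j\<in>Basis. (F x * (b \<bullet> j) + Z j b x) * d\<psi> j x * d\<psi> b x)
      = F x * G x + (\<Sum>b\<in>Basis. \<Sum>j\<in>Basis. Z j b x * d\<psi> j x * d\<psi> b x)" for x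
  proof -
    have "(\<Sum>j\<in>Basis. F x * (b \<bullet> j) * d\<psi> j x * d\<psi> b x) = F x * (d\<psi> b x)\<^sup>2" if "b \<in> Basis" for b
    proof -
      have "(\<Sum>j\<in>Basis. F x * (b \<bullet> j) * d\<psi> j x * d\<psi> b x)
          = (\<Sum>j\<in>Basis. if b = j then F x * (d\<psi> b x)\<^sup>2 else 0)"
        using that by (intro sum.cong refl) (auto simp: inner_Basis power2_eq_square)
      then show ?thesis using that by simp
    qed
    then show ?thesis
      by (simp add: G_def sum_distrib_left distrib_right sum.distrib)
  qed
  have U0: "(\<integral>x. (\<Sum>b\<in>Basis. X b x * dv b x) * (\<psi> x)\<^sup>2 \<partial>lborel) \<le> c\<^sub>1 * U"
  proof -
    have "integrable lborel (\<lambda>x. (\<Sum>b\<in>Basis. X b x * dv b x) * (\<psi> x)\<^sup>2)"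
      by (rule integrable_continuous_compact_support[OF _ compact_K])
         (auto intro!: continuous_intros cont simp: supp)
    then have "(\<integral>x. (\<Sum>b\<in>Basis. X b x * dv b x) * (\<psi> x)\<^sup>2 \<partial>lborel) \<le> (\<integral>x. c\<^sub>1 * (v x * (\<psi> x)\<^sup>2) \<partial>lborel)"
      using integrable_potential mult_right_mono[OF X_le, of "(\<psi> x)\<^sup>2" x for x]
      by (intro Bochner_Integration.integral_mono) (auto simp: mult.assoc)
    then show ?thesis by (simp add: potential_energy_def)
  qed
  have "2 * h\<^sup>2 * (\<integral>x. (\<Sum>b\<in>Basis. \<Sum>j\<in>Basis. (F x * (b \<bullet> j) + Z j b x) * d\<psi> j x * d\<psi> b x) \<partial>lborel)
      + h\<^sup>2 * I2 = (\<integral>x. (\<Sum>b\<in>Basis. X b x * dv b x) * (\<psi> x)\<^sup>2 \<partial>lborel)"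
    unfolding I2_def
    by (rule virial_identity[OF dX dg cont(3) _ cont(5) compact_K])
       (auto intro!: continuous_intros cont simp: supp supp')
  then have "2 * h\<^sup>2 * (T + I3) + h\<^sup>2 * I2 \<le> c\<^sub>1 * U"
    unfolding Fsum using iZ integrable_\<eta> U0 by (simp add: T_def I3_def)
  moreover have "h\<^sup>2 * - I3 \<le> h\<^sup>2 * (B * ?d * J)" "h\<^sup>2 * - I2 \<le> h\<^sup>2 * (B / 2 * (?d * Q + J))"
      "h\<^sup>2 * I1 \<le> h\<^sup>2 * (B / 2 * (?d * Q + J))"
    using I12 I3 by (intro mult_left_mono; simp)+
  moreover have "E - U \<le> h\<^sup>2 * T + h\<^sup>2 * I1"
  proof -
    have "E - U = (\<integral>x. E * (\<psi> x)\<^sup>2 - v x * (\<psi> x)\<^sup>2 \<partial>lborel)"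
      using integrable_sq integrable_potential integral_sq by (simp add: potential_energy_def)
    \<comment> \<open>Inserting \<open>F\<close> can only increase the integral of
      \<open>(E - v) \<psi>\<^sup>2\<close>, since \<open>v \<ge> E\<close> wherever
      \<open>F\<close> is below 1.\<close>
    also have "\<dots> \<le> (\<integral>x. - (F x * ((v x - E) * (\<psi> x)\<^sup>2)) \<partial>lborel)"
    proof (intro Bochner_Integration.integral_mono)
      show "E * (\<psi> x)\<^sup>2 - v x * (\<psi> x)\<^sup>2 \<le> - (F x * ((v x - E) * (\<psi> x)\<^sup>2))" for x
      proof -
        have "0 \<le> (1 - F x) * (v x - E)"
          using F_bounds(2,3)[of x] E_le by (cases "F x = 1") auto
        then have "0 \<le> (1 - F x) * (v x - E) * (\<psi> x)\<^sup>2" by simp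
        then show ?thesis by (simp add: algebra_simps)
      qed
    qed (use integrable_sq integrable_potential integrable_\<eta> in auto)
    also have "\<dots> = - (\<integral>x. (v x - E) * (F x * (\<psi> x)\<^sup>2) \<partial>lborel)"
      by (simp add: mult_ac)
    also have "\<dots> = h\<^sup>2 * T + h\<^sup>2 * I1"
      using energy_identity[OF dF cont(1,2) compact_K supp(1) supp'(1)]
      by (simp add: T_def I1_def)
    finally show ?thesis .
  qed
  \<comment> \<open>\<open>I3\<close> enters with factor 2. The bound for cross terms is used three
    times, once for \<open>I2\<close> and twice for \<open>I1\<close> because the energy identity is
    doubled; this gives the coefficient \<open>3 / 2\<close>.\<close>
  ultimately have *: "2 * E \<le> 2 * U + c\<^sub>1 * U + h\<^sup>2 * (B * (2 * ?d * J + 3 / 2 * (?d * Q + J)))"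
  proof -
    assume "2 * h\<^sup>2 * (T + I3) + h\<^sup>2 * I2 \<le> c\<^sub>1 * U" "h\<^sup>2 * - I3 \<le> h\<^sup>2 * (B * ?d * J)"
      "h\<^sup>2 * - I2 \<le> h\<^sup>2 * (B / 2 * (?d * Q + J))"
      "h\<^sup>2 * I1 \<le> h\<^sup>2 * (B / 2 * (?d * Q + J))" "E - U \<le> h\<^sup>2 * T + h\<^sup>2 * I1"
    moreover have "2 * h\<^sup>2 * (T + I3) + h\<^sup>2 * I2 = 2 * (h\<^sup>2 * T) - 2 * (h\<^sup>2 * - I3) - h\<^sup>2 * - I2"
      by (simp add: algebra_simps)
    moreover have "h\<^sup>2 * (B * (2 * ?d * J + 3 / 2 * (?d * Q + J)))
        = 2 * (h\<^sup>2 * (B * ?d * J)) + 3 * (h\<^sup>2 * (B / 2 * (?d * Q + J)))"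
      by (simp add: algebra_simps)
    ultimately show ?thesis by linarith
  qed
  have "a * (B * (2 * ?d * J + 3 / 2 * (?d * Q + J)))
      = B * (2 * ?d * (a * J) + 3 / 2 * (?d * (a * Q) + a * J))"
    by (simp add: algebra_simps)
  also have "\<dots> \<le> B * (2 * ?d * (\<kappa> * U) + 3 / 2 * (?d * (M * U) + \<kappa> * U))"
    using JQ pos by (intro mult_left_mono add_mono) auto
  finally have "B * (2 * ?d * J + 3 / 2 * (?d * Q + J))
      \<le> B * (2 * ?d * \<kappa> + 3 / 2 * (?d * M + \<kappa>)) / a * U"
    using pos by (simp add: field_simps)
  then have "h\<^sup>2 * (B * (2 * ?d * J + 3 / 2 * (?d * Q + J)))
      \<le> h\<^sup>2 * (B * (2 * ?d * \<kappa> + 3 / 2 * (?d * M + \<kappa>)) / a * U)"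
    by (rule mult_left_mono) simp
  with * show ?thesis unfolding distrib_right mult.assoc by linarith
qed

end

section \<open>Construction of the multiplier\<close>

text \<open>An explicit step: with \<open>m\<close> the positive part and \<open>t\<close> the
  affine variable running from 0 at \<open>a\<close> to 1 at \<open>b\<close>, take the cube of
  \<open>m (1 - (m t) ^ 3)\<close>. The inner cube flattens the function to second order at
  \<open>a\<close>, the outer one at \<open>b\<close>.\<close>

lemma exists_C2_step:
  fixes a b :: real
  assumes "a < b"
  obtains f f1 f2 :: "real \<Rightarrow> real" where
    "\<And>s. (f has_real_derivative f1 s) (at s)" "\<And>s. (f1 has_real_derivative f2 s) (at s)"
    "continuous_on UNIV f2" "\<And>s. 0 \<le> f s" "\<And>s. f s \<le> 1" "\<And>s. s \<le> a \<Longrightarrow> f s = 1" "\<And>s. b \<le> s \<Longrightarrow> f s = 0"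
    "\<And>s. s \<notin> {a<..<b} \<Longrightarrow> f1 s = 0" "\<And>s. s \<notin> {a<..<b} \<Longrightarrow> f2 s = 0"
proof -
  define m where "m s = max 0 s" for s :: real
  have m3: "((\<lambda>s. (m s) ^ 3) has_real_derivative 3 * (m s)\<^sup>2) (at s)" for s
    using DERIV_max_0_power[of 1 s] by (simp add: m_def numeral_eq_Suc)
  have m2: "((\<lambda>s. (m s)\<^sup>2) has_real_derivative 2 * m s) (at s)" for s
    using DERIV_max_0_power2[of s] by (simp add: m_def)
  define t where "t s = (s - a) * inverse (b - a)" for s
  have dt: "(t has_real_derivative inverse (b - a)) (at s)" for s
    unfolding t_def by (auto intro!: derivative_eq_intros)
  define u where "u s = 1 - (m (t s)) ^ 3" for s
  define u1 where "u1 s = 0 - 3 * (m (t s))\<^sup>2 * inverse (b - a)" for s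
  have du: "(u has_real_derivative u1 s) (at s)" for s
    unfolding u_def u1_def by (intro DERIV_diff DERIV_const DERIV_chain2[OF m3 dt])
  define u2 where "u2 s = 0 - 3 * (2 * m (t s) * inverse (b - a)) * inverse (b - a)" for s
  have du1: "(u1 has_real_derivative u2 s) (at s)" for s
    unfolding u1_def u2_def
    by (intro DERIV_diff DERIV_const DERIV_cmult_right DERIV_cmult DERIV_chain2[OF m2 dt])
  define f where "f s = (m (u s)) ^ 3" for s
  define f1 where "f1 s = 3 * (m (u s))\<^sup>2 * u1 s" for s
  define f2 where "f2 s = 3 * (2 * m (u s) * u1 s) * u1 s + u2 s * (3 * (m (u s))\<^sup>2)" for s
  have lo: "m (t s) = 0" if "s \<le> a" for s
    using that assms by (simp add: m_def t_def mult_nonpos_nonneg)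
  have hi: "m (u s) = 0" if "b \<le> s" for s
  proof -
    have "1 \<le> t s" using that assms by (simp add: t_def field_simps)
    then have "1 \<le> (m (t s)) ^ 3" by (intro one_le_power) (simp add: m_def)
    then show ?thesis by (simp add: m_def u_def)
  qed
  show ?thesis
  proof
    show "(f has_real_derivative f1 s) (at s)" for s
      unfolding f_def f1_def by (rule DERIV_chain2[OF m3 du])
    show "(f1 has_real_derivative f2 s) (at s)" for s
      unfolding f1_def f2_def by (intro DERIV_mult DERIV_cmult DERIV_chain2[OF m2 du] du1)
    show "continuous_on UNIV f2"
      unfolding f2_def u_def u1_def u2_def m_def t_def by (intro continuous_intros)
    have "0 \<le> m (u s)" "m (u s) \<le> 1" for s by (simp_all add: m_def u_def)
    then show "0 \<le> f s" "f s \<le> 1" for s by (simp_all add: f_def power_le_one)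
    show "f s = 1" if "s \<le> a" for s using lo[OF that] by (simp add: f_def u_def m_def)
    show "f s = 0" if "b \<le> s" for s using hi[OF that] by (simp add: f_def)
    show "f1 s = 0" "f2 s = 0" if "s \<notin> {a<..<b}" for s
      using that lo[of s] hi[of s] by (cases "s \<le> a"; simp add: f1_def f2_def u1_def u2_def)+
  qed
qed

lemma bounded_continuous_family_compact_support:
  fixes k :: "'i \<Rightarrow> 'a::euclidean_space \<Rightarrow> real"
  assumes "finite I" "\<And>i. i \<in> I \<Longrightarrow> continuous_on UNIV (k i)" "compact K"
    "\<And>i x. i \<in> I \<Longrightarrow> x \<notin> K \<Longrightarrow> k i x = 0"
  shows "\<exists>B>0. \<forall>i\<in>I. \<forall>x. \<bar>k i x\<bar> \<le> B"
proof -
  have "continuous_on UNIV (\<lambda>x. \<Sum>i\<in>I. \<bar>k i x\<bar>)" by (intro continuous_intros assms)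
  then obtain B where B: "B > 0" "\<And>x. \<bar>\<Sum>i\<in>I. \<bar>k i x\<bar>\<bar> \<le> B"
    using bounded_continuous_compact_support[of "\<lambda>x. \<Sum>i\<in>I. \<bar>k i x\<bar>" K] assms by auto
  have "\<bar>k i x\<bar> \<le> B" if "i \<in> I" for i x
  proof -
    have "\<bar>k i x\<bar> \<le> (\<Sum>i\<in>I. \<bar>k i x\<bar>)"
      using that assms(1) by (intro member_le_sum) auto
    then show ?thesis using B(2)[of x] by linarith
  qed
  with B(1) show ?thesis by blast
qed

text \<open>Here \<open>q\<close> may be arbitrary away from the wells, so it is treated as a
  parameter \<open>r\<close> of \<open>k\<close>. It is enough that the composite
  \<open>k y (q y)\<close> agrees near each point with the function in which the parameter is
  frozen.\<close>

lemma has_dir_deriv_frozen: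
  assumes "\<And>x. \<exists>S. open S \<and> x \<in> S \<and> (\<forall>y\<in>S. k y (q y) = k y (q x))"
    and "\<And>r. has_dir_deriv b (\<lambda>y. k y r) (k' r) x"
  shows "has_dir_deriv b (\<lambda>y. k y (q y)) (k' (q x)) x"
proof -
  obtain S where S: "open S" "x \<in> S" "\<forall>y\<in>S. k y (q y) = k y (q x)" using assms(1) by blast
  show ?thesis
    by (rule has_dir_deriv_transform[OF assms(2) S(1,2)]) (rule S(3)[rule_format, symmetric])
qed

lemma continuous_on_frozen:
  fixes k :: "'a::euclidean_space \<Rightarrow> 'b \<Rightarrow> real"
  assumes "\<And>x. \<exists>S. open S \<and> x \<in> S \<and> (\<forall>y\<in>S. k y (q y) = k y (q x))"
    and "\<And>r. continuous_on UNIV (\<lambda>y. k y r)"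
  shows "continuous_on UNIV (\<lambda>y. k y (q y))"
proof -
  have "isCont (\<lambda>y. k y (q y)) x" for x
  proof -
    obtain S where "open S" "x \<in> S" "\<forall>y\<in>S. k y (q y) = k y (q x)" using assms(1) by blast
    then have "eventually (\<lambda>y. k y (q y) = k y (q x)) (nhds x)"
      by (auto simp: eventually_nhds)
    then have "isCont (\<lambda>y. k y (q y)) x \<longleftrightarrow> isCont (\<lambda>y. k y (q x)) x" by (rule isCont_cong)
    then show ?thesis using assms(2)[of "q x"] by (simp add: continuous_on_eq_continuous_at)
  qed
  then show ?thesis by (simp add: continuous_on_eq_continuous_at)
qed

text \<open>The four levels between \<open>e + \<delta>\<close> and \<open>e + 4 * \<delta>\<close>
  nest the supports: the step varies between the two middle levels, while \<eta> is positive between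
  the outer two. Thus \<eta> is bounded below wherever a derivative of the step is nonzero, and
  still lives where \<open>v \<ge> e + \<delta>\<close>.\<close>

lemma exists_virial_multiplier:
  fixes v :: "'a::euclidean_space \<Rightarrow> real" and q :: "'a \<Rightarrow> 'a"
  assumes v: "C_infinity v" "\<And>x. 0 \<le> v x"
    and \<delta>: "0 < \<delta>" and e: "0 < e" and c1: "0 \<le> c\<^sub>1"
    and compact: "compact {x. v x \<le> e + 4 * \<delta>}"
    and q: "\<And>x. v x < e + 4 * \<delta> \<Longrightarrow> \<exists>S. open S \<and> x \<in> S \<and> (\<forall>y\<in>S. q y = q x)"
    and le: "\<And>x. v x < e + 4 * \<delta> \<Longrightarrow> (x - q x) \<bullet> grad v x \<le> c\<^sub>1 * v x"
  shows "\<exists>F F' X Z g' \<eta> \<eta>' K B \<kappa> M. virial_multiplier v (e + \<delta>) c\<^sub>1 F F' X Z g' \<eta> \<eta>' K B \<kappa> M"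
proof -
  obtain f f1 f2 :: "real \<Rightarrow> real" where f:
    "\<And>s. (f has_real_derivative f1 s) (at s)" "\<And>s. (f1 has_real_derivative f2 s) (at s)"
    "continuous_on UNIV f2" "\<And>s. 0 \<le> f s" "\<And>s. f s \<le> 1"
    "\<And>s. s \<le> e + 2 * \<delta> \<Longrightarrow> f s = 1" "\<And>s. e + 3 * \<delta> \<le> s \<Longrightarrow> f s = 0"
    "\<And>s. s \<notin> {e + 2 * \<delta><..<e + 3 * \<delta>} \<Longrightarrow> f1 s = 0" "\<And>s. s \<notin> {e + 2 * \<delta><..<e + 3 * \<delta>} \<Longrightarrow> f2 s = 0"
    using exists_C2_step[of "e + 2 * \<delta>" "e + 3 * \<delta>"] \<delta> by auto
  let ?dv = "\<lambda>b. partial_deriv b v" and ?ddv = "\<lambda>j b. partial_deriv b (partial_deriv j v)"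
  have Cv: "C_k k v" for k using v by (simp add: C_infinity_def)
  have Cdv: "C_k k (?dv b)" if "b \<in> Basis" for k b using Cv[of "Suc k"] that by simp
  have Cddv: "C_k k (?ddv j b)" if "b \<in> Basis" "j \<in> Basis" for k b j using Cdv[of j "Suc k"] that by simp
  have cv: "continuous_on UNIV v" "\<And>b. b \<in> Basis \<Longrightarrow> continuous_on UNIV (?dv b)"
      "\<And>b j. b \<in> Basis \<Longrightarrow> j \<in> Basis \<Longrightarrow> continuous_on UNIV (?ddv j b)"
    by (blast intro: C_k_imp_continuous Cv Cdv Cddv)+
  have dv: "has_dir_deriv b v (?dv b x) x" for b x by (rule C_k_Suc_has_dir_deriv[OF Cv])
  have ddv: "has_dir_deriv b (?dv j) (?ddv j b x) x" if "j \<in> Basis" for b j x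
    by (rule C_k_Suc_has_dir_deriv[OF Cdv[OF that]])
  have cf: "continuous_on UNIV f" "continuous_on UNIV f1"
    using f(1,2) by (auto simp: continuous_on_eq_continuous_at intro: DERIV_isCont)
  have cfv: "continuous_on UNIV (\<lambda>x. f (v x))" "continuous_on UNIV (\<lambda>x. f1 (v x))"
      "continuous_on UNIV (\<lambda>x. f2 (v x))"
    by (rule continuous_on_compose2[OF cf(1) cv(1)] continuous_on_compose2[OF cf(2) cv(1)]
        continuous_on_compose2[OF f(3) cv(1)]; simp)+
  note cint = continuous_intros cv cfv
  note dfv = has_dir_deriv_chain[where k = f, OF f(1) dv] has_dir_deriv_chain[where k = f1, OF f(2) dv]
  define K where "K = {x. v x \<le> e + 4 * \<delta>}"
  have K: "compact K" using compact by (simp add: K_def)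
  \<comment> \<open>The regions \<open>v < e + 4 * \<delta>\<close>, where \<open>q\<close> is
    locally constant, and \<open>v > e + 3 * \<delta>\<close>, where \<open>k\<close> vanishes for
    every value of the parameter, are open and cover the space.\<close>
  have frozen: "\<exists>S. open S \<and> x \<in> S \<and> (\<forall>y\<in>S. k y (q y) = k y (q x))"
    if k: "\<And>y r. e + 3 * \<delta> < v y \<Longrightarrow> k y r = 0" for k :: "'a \<Rightarrow> 'a \<Rightarrow> real" and x
  proof (cases "v x < e + 4 * \<delta>")
    case True
    obtain S where S: "open S" "x \<in> S" "\<And>y. y \<in> S \<Longrightarrow> q y = q x" using q[OF True] by blast
    have "\<forall>y\<in>S. k y (q y) = k y (q x)" by (intro ballI arg_cong[OF S(3)])
    then show ?thesis using S(1,2) by blast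
  next
    case False
    have "open {y. e + 3 * \<delta> < v y}"
      by (intro open_Collect_less continuous_intros cv)
    then show ?thesis using False \<delta> k by (intro exI[of _ "{y. e + 3 * \<delta> < v y}"]) auto
  qed
  have cont_frozen: "continuous_on UNIV (\<lambda>y. k y (q y))"
    if "\<And>y r. e + 3 * \<delta> < v y \<Longrightarrow> k y r = 0" "\<And>r. continuous_on UNIV (\<lambda>y. k y r)"
    for k :: "'a \<Rightarrow> 'a \<Rightarrow> real"
    by (rule continuous_on_frozen[where k = k and q = q, OF frozen[where k = k]]) (use that in auto)
  have deriv_frozen: "has_dir_deriv b (\<lambda>y. k y (q y)) (k' (q x)) x"
    if "\<And>y r. e + 3 * \<delta> < v y \<Longrightarrow> k y r = 0" "\<And>r. has_dir_deriv b (\<lambda>y. k y r) (k' r) x"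
    for k :: "'a \<Rightarrow> 'a \<Rightarrow> real" and k' b x
    by (rule has_dir_deriv_frozen[where k = k and q = q, OF frozen[where k = k]]) (use that in auto)
  define X where "X j x = f (v x) * (x \<bullet> j - q x \<bullet> j)" for j x
  define F' where "F' b x = f1 (v x) * ?dv b x" for b x
  define Z where "Z j b x = (f1 (v x) * ?dv b x) * (x \<bullet> j - q x \<bullet> j)" for j b x
  \<comment> \<open>The summands \<open>0 * f (v x)\<close> and \<open>- 0\<close> keep the exact
    form produced by the product and difference rules.\<close>
  define g' where "g' c x = (\<Sum>b\<in>Basis. (f1 (v x) * ?dv c x) * (b \<bullet> b) + 0 * f (v x)
     + ((f2 (v x) * ?dv c x * ?dv b x + ?ddv b c x * f1 (v x)) * (x \<bullet> b - q x \<bullet> b)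
       + (c \<bullet> b - 0) * (f1 (v x) * ?dv b x)))" for c x
  define p where "p s = (s - (e + \<delta>)) * ((e + 4 * \<delta>) - s)" for s
  define \<eta> where "\<eta> x = (max 0 (p (v x)))\<^sup>2" for x
  define \<eta>' where "\<eta>' b x = 2 * max 0 (p (v x)) * ((?dv b x - 0) * ((e + 4 * \<delta>) - v x)
     + (0 - ?dv b x) * (v x - (e + \<delta>)))" for b x
  have dX: "has_dir_deriv b (X j) (f (v x) * (b \<bullet> j) + Z j b x) x" for j b x
  proof -
    have "has_dir_deriv b (\<lambda>y. f (v y) * (y \<bullet> j - q y \<bullet> j))
        ((f1 (v x) * ?dv b x) * (x \<bullet> j - q x \<bullet> j) + (b \<bullet> j - 0) * f (v x)) x"
      by (rule deriv_frozen[where k = "\<lambda>y r. f (v y) * (y \<bullet> j - r \<bullet> j)"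
          and k' = "\<lambda>r. (f1 (v x) * ?dv b x) * (x \<bullet> j - r \<bullet> j) + (b \<bullet> j - 0) * f (v x)"],
          simp add: f, intro has_dir_deriv_mult has_dir_deriv_diff has_dir_deriv_inner has_dir_deriv_const dfv)
    then show ?thesis by (simp add: X_def[abs_def] Z_def mult.commute add.commute)
  qed
  have dg: "has_dir_deriv c (\<lambda>x. \<Sum>b\<in>Basis. f (v x) * (b \<bullet> b) + Z b b x) (g' c x) x" for c x
    unfolding g'_def Z_def
  proof (rule has_dir_deriv_sum)
    fix b :: 'a assume b: "b \<in> Basis"
    show "has_dir_deriv c (\<lambda>x. f (v x) * (b \<bullet> b) + f1 (v x) * ?dv b x * (x \<bullet> b - q x \<bullet> b))
        ((f1 (v x) * ?dv c x) * (b \<bullet> b) + 0 * f (v x)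
         + ((f2 (v x) * ?dv c x * ?dv b x + ?ddv b c x * f1 (v x)) * (x \<bullet> b - q x \<bullet> b)
           + (c \<bullet> b - 0) * (f1 (v x) * ?dv b x))) x"
      by (rule deriv_frozen[where k = "\<lambda>x r. f (v x) * (b \<bullet> b) + f1 (v x) * ?dv b x * (x \<bullet> b - r \<bullet> b)"
          and k' = "\<lambda>r. (f1 (v x) * ?dv c x) * (b \<bullet> b) + 0 * f (v x)
         + ((f2 (v x) * ?dv c x * ?dv b x + ?ddv b c x * f1 (v x)) * (x \<bullet> b - r \<bullet> b)
           + (c \<bullet> b - 0) * (f1 (v x) * ?dv b x))"], simp add: f,
          intro has_dir_deriv_add has_dir_deriv_mult has_dir_deriv_diff has_dir_deriv_inner
          has_dir_deriv_const dfv ddv b)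
  qed
  have d\<eta>: "has_dir_deriv b \<eta> (\<eta>' b x) x" for b x
    unfolding \<eta>_def \<eta>'_def p_def
    by (intro has_dir_deriv_chain[where k = "\<lambda>s. (max 0 s)\<^sup>2"] DERIV_max_0_power2 has_dir_deriv_mult
        has_dir_deriv_diff has_dir_deriv_const dv)
  have cX: "continuous_on UNIV (X j)" for j
    unfolding X_def
    by (rule cont_frozen[where k = "\<lambda>x r. f (v x) * (x \<bullet> j - r \<bullet> j)"])
       (auto simp: f intro!: cint)
  have cZ: "continuous_on UNIV (Z j b)" if "b \<in> Basis" for j b
    unfolding Z_def
    by (rule cont_frozen[where k = "\<lambda>x r. f1 (v x) * ?dv b x * (x \<bullet> j - r \<bullet> j)"])
       (auto simp: f that intro!: cint)
  have cg: "continuous_on UNIV (g' c)" if "c \<in> Basis" for c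
    unfolding g'_def
    by (rule cont_frozen[where k = "\<lambda>x r. \<Sum>b\<in>Basis. (f1 (v x) * ?dv c x) * (b \<bullet> b) + 0 * f (v x)
         + ((f2 (v x) * ?dv c x * ?dv b x + ?ddv b c x * f1 (v x)) * (x \<bullet> b - r \<bullet> b)
           + (c \<bullet> b - 0) * (f1 (v x) * ?dv b x))"])
       (auto simp: f that intro!: cint)
  have cF': "continuous_on UNIV (F' b)" if "b \<in> Basis" for b
    unfolding F'_def by (intro cint that)
  have c\<eta>: "continuous_on UNIV \<eta>" unfolding \<eta>_def p_def by (intro cint)
  have c\<eta>': "continuous_on UNIV (\<eta>' b)" if "b \<in> Basis" for b
    unfolding \<eta>'_def p_def by (intro cint that)
  have trans0: "F' b x = 0" "Z j b x = 0" "g' b x = 0" if "v x \<notin> {e + 2 * \<delta><..<e + 3 * \<delta>}" for j b x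
    using f(8,9)[OF that] by (simp_all add: F'_def Z_def g'_def)
  have notK: "v x \<notin> {e + 2 * \<delta><..<e + 3 * \<delta>}" if "x \<notin> K" for x
    using that \<delta> by (auto simp: K_def)
  obtain B1 where B1: "B1 > 0" "\<forall>b\<in>Basis. \<forall>x. \<bar>F' b x\<bar> \<le> B1"
    using bounded_continuous_family_compact_support[of Basis F', OF finite_Basis cF' K trans0(1)[OF notK]]
    by auto
  have finite_BB: "finite (Basis \<times> Basis :: ('a \<times> 'a) set)" by simp
  have cZ': "continuous_on UNIV (\<lambda>x. Z (fst i) (snd i) x)" if "i \<in> Basis \<times> Basis" for i
    using that cZ[of "snd i" "fst i"] by auto
  obtain B2 where B2: "B2 > 0" "\<forall>i\<in>Basis \<times> Basis. \<forall>x. \<bar>Z (fst i) (snd i) x\<bar> \<le> B2"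
    using bounded_continuous_family_compact_support
      [of "Basis \<times> Basis" "\<lambda>i. Z (fst i) (snd i)", OF finite_BB cZ' K trans0(2)[OF notK]]
    by auto
  obtain B3 where B3: "B3 > 0" "\<forall>b\<in>Basis. \<forall>x. \<bar>g' b x\<bar> \<le> B3"
    using bounded_continuous_family_compact_support[of Basis g', OF finite_Basis cg K trans0(3)[OF notK]]
    by auto
  \<comment> \<open>\<open>4 * \<delta> ^ 4\<close> is the lower bound of \<eta> on the transition
    shell of the step, so \<open>B * \<eta> x\<close> is at least \<open>B1 + B2 + B3\<close>
    there.\<close>
  define B where "B = (B1 + B2 + B3) / (4 * \<delta> ^ 4)"
  have p_pos: "e + \<delta> < v x \<and> v x < e + 4 * \<delta>" if "0 < p (v x)" for x
    using that \<delta> by (auto simp: p_def zero_less_mult_iff)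
  have p_neg: "max 0 (p (v x)) = 0" if "x \<notin> K" for x
    using p_pos[of x] that by (cases "0 < p (v x)") (auto simp: K_def)
  have \<eta>0: "0 \<le> \<eta> x" for x by (simp add: \<eta>_def)
  have \<eta>_lower: "4 * \<delta> ^ 4 \<le> \<eta> x" if "v x \<in> {e + 2 * \<delta><..<e + 3 * \<delta>}" for x
  proof -
    have "0 \<le> (v x - (e + 2 * \<delta>)) * ((e + 3 * \<delta>) - v x)" using that by simp
    \<comment> \<open>Expanding shows that \<open>p (v x)\<close> is
      \<open>2 * \<delta>\<^sup>2\<close> plus the product just shown to be nonnegative.\<close>
    then have "2 * \<delta>\<^sup>2 \<le> p (v x)"
      by (simp add: p_def algebra_simps power2_eq_square)
    then have "(2 * \<delta>\<^sup>2)\<^sup>2 \<le> (max 0 (p (v x)))\<^sup>2" by (intro power_mono) auto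
    then show ?thesis by (simp add: \<eta>_def power_mult_distrib)
  qed
  have dominate: "\<bar>y\<bar> \<le> B * \<eta> x"
    if "\<bar>y\<bar> \<le> C" "C \<le> B1 + B2 + B3" "v x \<notin> {e + 2 * \<delta><..<e + 3 * \<delta>} \<Longrightarrow> y = 0" for y x C
  proof (cases "v x \<in> {e + 2 * \<delta><..<e + 3 * \<delta>}")
    case True
    have "\<bar>y\<bar> \<le> B * (4 * \<delta> ^ 4)" using that \<delta> by (simp add: B_def)
    also have "\<dots> \<le> B * \<eta> x"
      using \<eta>_lower[OF True] B1(1) B2(1) B3(1) \<delta> by (intro mult_left_mono) (auto simp: B_def)
    finally show ?thesis .
  next
    case False
    then show ?thesis using that(3) \<eta>0[of x] B1(1) B2(1) B3(1) \<delta> by (simp add: B_def)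
  qed
  \<comment> \<open>Since \<eta> is the square of the positive part of \<open>p (v x)\<close>, its
    squared gradient is exactly \<open>r x * \<eta> x\<close>; \<kappa> is a bound of
    \<open>r\<close> on the compact set \<open>K\<close>.\<close>
  define r where "r x = 4 * ((e + 4 * \<delta>) - v x - (v x - (e + \<delta>)))\<^sup>2 * (\<Sum>b\<in>Basis. (?dv b x)\<^sup>2)" for x
  have cr: "continuous_on UNIV r" unfolding r_def by (intro cint)
  have "compact (r ` K)"
    by (rule compact_continuous_image[OF continuous_on_subset[OF cr subset_UNIV] K])
  then obtain \<kappa> where \<kappa>: "\<kappa> > 0" "\<forall>y\<in>r ` K. norm y \<le> \<kappa>"
    using compact_imp_bounded[of "r ` K"] unfolding bounded_pos by blast
  have gr: "(\<Sum>b\<in>Basis. (\<eta>' b x)\<^sup>2) \<le> \<kappa> * \<eta> x" for x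
  proof (cases "x \<in> K")
    case True
    have "(\<Sum>b\<in>Basis. (\<eta>' b x)\<^sup>2) = (\<Sum>b\<in>Basis.
        4 * ((e + 4 * \<delta>) - v x - (v x - (e + \<delta>)))\<^sup>2 * \<eta> x * (?dv b x)\<^sup>2)"
      unfolding \<eta>'_def \<eta>_def by (intro sum.cong refl) algebra
    also have "\<dots> = r x * \<eta> x"
      by (simp add: r_def sum_distrib_left[symmetric])
    also have "\<dots> \<le> \<kappa> * \<eta> x"
      using \<kappa>(2) True \<eta>0[of x] by (intro mult_right_mono) auto
    finally show ?thesis .
  next
    case False
    then show ?thesis by (simp add: \<eta>'_def \<eta>_def p_neg)
  qed
  obtain M where M: "M > 0" "\<And>x. \<bar>\<eta> x\<bar> \<le> M"
    using bounded_continuous_compact_support[OF c\<eta> K] p_neg by (auto simp: \<eta>_def)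
  have "virial_multiplier v (e + \<delta>) c\<^sub>1 (\<lambda>x. f (v x)) F' X Z g' \<eta> \<eta>' K B \<kappa> M"
  proof
    show "has_dir_deriv b (\<lambda>x. f (v x)) (F' b x) x" for b x
      unfolding F'_def by (rule dfv)
    show "f (v x) = 0" if "x \<notin> K" for x using that \<delta> by (intro f) (simp add: K_def)
    then show "X j x = 0" if "x \<notin> K" for j x using that by (simp add: X_def)
    show "\<eta> x = 0" "\<eta>' b x = 0" if "x \<notin> K" for b x using p_neg[OF that] by (simp_all add: \<eta>_def \<eta>'_def)
    show "e + \<delta> \<le> v x" if "f (v x) \<noteq> 1" for x using f(6)[of "v x"] that \<delta> by (cases "v x \<le> e + 2 * \<delta>") auto
    show "(\<Sum>b\<in>Basis. X b x * ?dv b x) \<le> c\<^sub>1 * v x" for x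
    proof -
      have eq: "(\<Sum>b\<in>Basis. X b x * ?dv b x) = f (v x) * ((x - q x) \<bullet> grad v x)"
        by (simp add: X_def grad_def inner_sum_right inner_diff_left sum_distrib_left algebra_simps)
      show ?thesis
      proof (cases "v x < e + 4 * \<delta>")
        case True
        have "f (v x) * ((x - q x) \<bullet> grad v x) \<le> f (v x) * (c\<^sub>1 * v x)"
          using le[OF True] f(4) by (intro mult_left_mono) auto
        also have "\<dots> \<le> c\<^sub>1 * v x"
          using f(4,5) c1 v(2)[of x] by (intro mult_left_le_one_le) auto
        finally show ?thesis by (simp add: eq)
      next
        case False
        then show ?thesis using f(7)[of "v x"] \<delta> c1 v(2)[of x] by (simp add: eq)
      qed
    qed
    show "\<bar>F' b x\<bar> \<le> B * \<eta> x" if "b \<in> Basis" for b x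
      by (rule dominate[OF B1(2)[rule_format, OF that]]) (simp_all add: B1(1) B2(1) B3(1) trans0 less_imp_le)
    show "\<bar>Z j b x\<bar> \<le> B * \<eta> x" if "j \<in> Basis" "b \<in> Basis" for j b x
      using that B2(2)[rule_format, of "(j, b)" x]
      by (intro dominate[where C = B2]) (simp_all add: B1(1) B2(1) B3(1) trans0 less_imp_le)
    show "\<bar>g' b x\<bar> \<le> B * \<eta> x" if "b \<in> Basis" for b x
      by (rule dominate[OF B3(2)[rule_format, OF that]]) (simp_all add: B1(1) B2(1) B3(1) trans0 less_imp_le)
    show "\<eta> x \<le> M" for x using M(2)[of x] by simp
    show "e + \<delta> \<le> v x" if "\<eta> x \<noteq> 0" for x
    proof -
      have "0 < p (v x)" using that by (cases "p (v x) \<le> 0") (auto simp: \<eta>_def)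
      then show ?thesis using p_pos[of x] by simp
    qed
    show "0 < e + \<delta>" "0 \<le> B" "0 \<le> \<kappa>" using e \<delta> B1(1) B2(1) B3(1) \<kappa>(1) by (simp_all add: B_def)
  qed (assumption | rule dX dg d\<eta> cfv(1) cF' cX cZ cg c\<eta> c\<eta>' K f(4) f(5) gr \<eta>0)+
  then show ?thesis by (intro exI)
qed

section \<open>Extending the virial condition above the energy\<close>

lemma compact_sublevel:
  fixes v :: "'a::euclidean_space \<Rightarrow> real"
  assumes "continuous_on UNIV v" "ereal L < v_infty v"
  shows "compact {x. v x \<le> L}"
proof -
  have "eventually (\<lambda>x. ereal L < ereal (v x)) at_infinity"
    using assms(2) unfolding v_infty_def by (rule less_LiminfD)
  then obtain r where r: "\<And>x. r \<le> norm x \<Longrightarrow> L < v x"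
    unfolding eventually_at_infinity by auto
  have "{x. v x \<le> L} \<subseteq> cball 0 r"
  proof
    fix x assume "x \<in> {x. v x \<le> L}"
    then show "x \<in> cball 0 r" using r[of x] by (cases "r \<le> norm x") auto
  qed
  moreover have "closed {x. v x \<le> L}"
    by (intro closed_Collect_le assms continuous_intros)
  ultimately show ?thesis
    using bounded_subset[OF bounded_cball] compact_eq_bounded_closed by blast
qed

text \<open>Noncriticality gives a direction, \<open>b\<close> or \<open>- b\<close>, in which
  \<open>v\<close> strictly decreases. Hence \<open>x\<close> is a limit of points of
  \<open>S\<close> with \<open>v < e\<close>, and the inequality passes to \<open>x\<close> by
  continuity.\<close>

lemma nonpos_at_noncritical:
  fixes v k :: "'a::euclidean_space \<Rightarrow> real"
  assumes v: "v differentiable_on UNIV" "noncritical v e" "v x = e"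
    and k: "isCont k x" "open S" "x \<in> S" "\<And>y. y \<in> S \<Longrightarrow> v y < e \<Longrightarrow> k y \<le> 0"
  shows "k x \<le> 0"
proof -
  have "grad v x \<noteq> 0" using v by (simp add: noncritical_def)
  have "\<exists>b. partial_deriv b v x \<noteq> 0"
  proof (rule ccontr)
    assume "\<nexists>b. partial_deriv b v x \<noteq> 0"
    then have "grad v x = 0" by (simp add: grad_def)
    with \<open>grad v x \<noteq> 0\<close> show False ..
  qed
  then obtain b where "partial_deriv b v x \<noteq> 0" ..
  moreover have "partial_deriv (- b) v x = - partial_deriv b v x"
    using linear_neg[OF linear_frechet_derivative, of v "at x" b] v(1)
    by (simp add: partial_deriv_def differentiable_on_def)
  ultimately have "partial_deriv b v x < 0 \<or> partial_deriv (- b) v x < 0" by linarith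
  then obtain u where u: "partial_deriv u v x < 0" by blast
  have "((\<lambda>t. v (x + t *\<^sub>R u)) has_real_derivative partial_deriv u v x) (at 0)"
    using has_dir_deriv_partial_deriv[OF v(1)] by (simp add: has_dir_deriv_def)
  from DERIV_neg_dec_right[OF this u] obtain d where
    d: "d > 0" "\<And>t. 0 < t \<Longrightarrow> t < d \<Longrightarrow> v (x + t *\<^sub>R u) < e"
    using v(3) by auto
  have lim: "((\<lambda>t. x + t *\<^sub>R u) \<longlongrightarrow> x) (at_right 0)"
  proof -
    have "((\<lambda>t. x + t *\<^sub>R u) \<longlongrightarrow> x + 0 *\<^sub>R u) (at_right 0)" by (intro tendsto_intros)
    then show ?thesis by simp
  qed
  have "eventually (\<lambda>t. x + t *\<^sub>R u \<in> S) (at_right 0)"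
    using lim k(2,3) by (rule topological_tendstoD)
  moreover have "eventually (\<lambda>t. 0 < t \<and> t < d) (at_right (0::real))"
    using d(1) unfolding eventually_at_right_field by blast
  ultimately have "eventually (\<lambda>t. k (x + t *\<^sub>R u) \<le> 0) (at_right 0)"
    by eventually_elim (simp add: k(4) d(2))
  moreover have "((\<lambda>t. k (x + t *\<^sub>R u)) \<longlongrightarrow> k x) (at_right 0)"
    using k(1) lim by (rule isCont_tendsto_compose)
  ultimately show ?thesis
    by (intro tendsto_upperbound[where F = "at_right (0::real)"]) auto
qed

text \<open>By continuity the bound with constant \<open>c\<close> still holds on the level set
  \<open>v = e\<close>. There \<open>\<gamma> * v = \<gamma> * e\<close> is positive, so the bound
  with \<open>c + \<gamma>\<close> is strict, and compactness of a band above \<open>e\<close> makes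
  it survive up to a uniform higher level.\<close>

lemma virial_condition_extends:
  fixes v :: "'a::euclidean_space \<Rightarrow> real" and q :: "'a \<Rightarrow> 'a"
  assumes v: "C_infinity v" "\<And>x. 0 \<le> v x" "noncritical v e" "ereal e < v_infty v"
    and pos: "0 < e" "0 < \<epsilon>" "0 < \<gamma>"
    and q: "\<And>x. v x < e + \<epsilon> \<Longrightarrow> \<exists>S. open S \<and> x \<in> S \<and> (\<forall>y\<in>S. q y = q x)"
    and le: "\<And>x. v x < e \<Longrightarrow> (x - q x) \<bullet> grad v x \<le> c * v x"
  shows "\<exists>\<delta>>0. 4 * \<delta> \<le> \<epsilon> \<and> compact {x. v x \<le> e + 4 * \<delta>} \<and>
    (\<forall>x. v x < e + 4 * \<delta> \<longrightarrow> (x - q x) \<bullet> grad v x \<le> (c + \<gamma>) * v x)"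
proof -
  have Cv: "C_k n v" for n using v by (simp add: C_infinity_def)
  have cv: "continuous_on UNIV v" by (rule C_k_imp_continuous[OF Cv])
  have diff: "v differentiable_on UNIV" using Cv[of 1] by simp
  have "continuous_on UNIV (partial_deriv b v)" if "b \<in> Basis" for b
    using Cv[of 1] that by simp
  then have cg: "continuous_on UNIV (grad v)"
    unfolding grad_def by (intro continuous_intros)
  obtain L' where L': "e < L'" "ereal L' < v_infty v"
    using ereal_dense2[OF v(4)] by auto
  \<comment> \<open>Below \<open>L'\<close> sublevel sets are compact; below
    \<open>e + \<epsilon>\<close> the function \<open>q\<close> is locally constant. The band up to
    \<open>L\<close> must have both properties.\<close>
  define L where "L = min L' (e + \<epsilon> / 2)"
  have L: "e < L" "L < e + \<epsilon>" using L' pos by (auto simp: L_def)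
  have "ereal L \<le> ereal L'" by (simp add: L_def)
  then have "ereal L < v_infty v" using L'(2) by (rule le_less_trans)
  then have compact_L: "compact {x. v x \<le> L}" by (rule compact_sublevel[OF cv])
  have cont: "isCont (\<lambda>y. (y - q y) \<bullet> grad v y - a * v y) x" if x: "v x < e + \<epsilon>" for a x
  proof -
    obtain S where S: "open S" "x \<in> S" "\<And>y. y \<in> S \<Longrightarrow> q y = q x" using q[OF x] by blast
    have "eventually (\<lambda>y. y \<in> S) (nhds x)" using S(1,2) by (rule eventually_nhds_in_open)
    then have "eventually (\<lambda>y. (y - q y) \<bullet> grad v y - a * v y = (y - q x) \<bullet> grad v y - a * v y) (nhds x)"
      by eventually_elim (metis S(3))
    then have eq: "isCont (\<lambda>y. (y - q y) \<bullet> grad v y - a * v y) x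
        \<longleftrightarrow> isCont (\<lambda>y. (y - q x) \<bullet> grad v y - a * v y) x"
      by (rule isCont_cong)
    have "continuous_on UNIV (\<lambda>y. (y - q x) \<bullet> grad v y - a * v y)"
      by (intro continuous_intros cg cv)
    then show ?thesis unfolding eq by (simp add: continuous_on_eq_continuous_at)
  qed
  define k where "k y = (y - q y) \<bullet> grad v y - (c + \<gamma>) * v y" for y
  have level: "k x < 0" if "v x = e" for x
  proof -
    have "(x - q x) \<bullet> grad v x - c * v x \<le> 0"
      by (rule nonpos_at_noncritical[OF diff v(3) that cont open_UNIV])
         (use that pos le in auto)
    moreover have "0 < \<gamma> * v x" using that pos by simp
    ultimately show ?thesis by (simp add: k_def algebra_simps)
  qed
  define K where "K = {x. e \<le> v x \<and> v x \<le> L}"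
  have "K = {x. v x \<le> L} \<inter> {x. e \<le> v x}" by (auto simp: K_def)
  moreover have "closed {x. e \<le> v x}" by (intro closed_Collect_le cv continuous_intros)
  ultimately have K: "compact K" using compact_L by (simp add: compact_Int_closed)
  have "continuous_on K k"
    unfolding k_def using L by (intro continuous_at_imp_continuous_on ballI cont) (auto simp: K_def)
  then have "closed (K \<inter> k -` {0..})"
    using K by (intro continuous_closed_preimage) (auto simp: compact_imp_closed)
  then have bad: "compact (K \<inter> k -` {0..})"
    using K by (metis compact_Int_closed inf_left_idem)
  \<comment> \<open>The set of violations in the band is compact and misses the level
    \<open>e\<close>. The new level \<open>m\<close> is the minimum of \<open>v\<close> on it, or
    \<open>L\<close> if there is no violation.\<close>
  obtain m where m: "e < m" "m \<le> L" "\<And>x. e \<le> v x \<Longrightarrow> v x < m \<Longrightarrow> k x < 0"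
  proof (cases "K \<inter> k -` {0..} = {}")
    case True
    have "k x < 0" if "e \<le> v x" "v x < L" for x
    proof (rule ccontr)
      assume "\<not> k x < 0"
      then have "x \<in> K \<inter> k -` {0..}" using that by (simp add: K_def)
      with True show False by simp
    qed
    with L(1) show ?thesis by (intro that[of L]) auto
  next
    case False
    obtain x0 where x0: "x0 \<in> K \<inter> k -` {0..}" "\<forall>y\<in>K \<inter> k -` {0..}. v x0 \<le> v y"
      using continuous_attains_inf[OF bad False continuous_on_subset[OF cv subset_UNIV]] by blast
    have "v x0 \<noteq> e" using level[of x0] x0(1) by auto
    then have "e < v x0" "v x0 \<le> L" using x0(1) by (auto simp: K_def)
    moreover have "k x < 0" if "e \<le> v x" "v x < v x0" for x
    proof (rule ccontr)
      assume "\<not> k x < 0"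
      then have "x \<in> K \<inter> k -` {0..}" using that \<open>v x0 \<le> L\<close> by (simp add: K_def)
      with x0(2) that show False by force
    qed
    ultimately show ?thesis by (rule that)
  qed
  have "(x - q x) \<bullet> grad v x \<le> (c + \<gamma>) * v x" if "v x < m" for x
  proof (cases "v x < e")
    case True
    have "c * v x \<le> (c + \<gamma>) * v x" using v(2)[of x] pos by (intro mult_right_mono) auto
    with le[OF True] show ?thesis by linarith
  next
    case False
    then show ?thesis using m(3)[of x] that by (simp add: k_def)
  qed
  moreover have "compact {x. v x \<le> m}"
  proof -
    have "{x. v x \<le> m} = {x. v x \<le> L} \<inter> {x. v x \<le> m}" using m(2) by auto
    moreover have "closed {x. v x \<le> m}" by (intro closed_Collect_le cv continuous_intros)
    ultimately show ?thesis using compact_L by (metis compact_Int_closed)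
  qed
  moreover define \<delta> where "\<delta> = (m - e) / 4"
  have "m = e + 4 * \<delta>" by (simp add: \<delta>_def field_simps)
  ultimately show ?thesis
    using m(1,2) L by (intro exI[of _ \<delta>] conjI) simp_all
qed

theorem proposition3p7:
  fixes v :: "real ^ 'd \<Rightarrow> real"
    and E\<^sub>0 \<epsilon>\<^sub>0 c\<^sub>0 :: real
    and N :: nat
    and W :: "nat \<Rightarrow> (real ^ 'd) set"
    and p :: "nat \<Rightarrow> real ^ 'd"
  assumes "C_infinity v"
    and "\<forall>x. 0 \<le> v x" and "\<exists>x. v x = 0"
    and "0 < v_infty v"
    and "0 < E\<^sub>0" and "ereal E\<^sub>0 < v_infty v"
    and "noncritical v E\<^sub>0"
    and "0 < \<epsilon>\<^sub>0"
    and "sublevel v (E\<^sub>0 + \<epsilon>\<^sub>0) = (\<Union>n\<in>{1..N}. W n)"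
    and "\<forall>n\<in>{1..N}. open (W n)"
    and "\<forall>n\<in>{1..N}. \<forall>m\<in>{1..N}. n \<noteq> m \<longrightarrow> W n \<inter> W m = {}"
    and "0 < c\<^sub>0"
    and "\<forall>n\<in>{1..N}. p n \<in> sublevel v E\<^sub>0 \<inter> W n"
    and "\<forall>n\<in>{1..N}. \<forall>x\<in>sublevel v E\<^sub>0 \<inter> W n. (x - p n) \<bullet> grad v x \<le> c\<^sub>0 * v x"
  shows "\<forall>c < 2 / (c\<^sub>0 + 2). \<exists>\<epsilon>>0. \<exists>h\<^sub>0>0. \<forall>h E \<psi>.
           0 < h \<and> h < h\<^sub>0 \<and> E \<in> {E\<^sub>0 - \<epsilon>\<^sub>0 / 2 <..< E\<^sub>0 + \<epsilon>\<^sub>0 / 2} \<and> E < E\<^sub>0 + \<epsilon> \<and>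
           normalized_eigenfunction v h E \<psi> \<longrightarrow>
           potential_energy v \<psi> \<ge> c * E"
proof (intro allI impI)
  fix c :: real assume c: "c < 2 / (c\<^sub>0 + 2)"
  have U0: "0 \<le> potential_energy v \<psi>" for \<psi>
    unfolding potential_energy_def using assms(2) by (intro Bochner_Integration.integral_nonneg) auto
  show "\<exists>\<epsilon>>0. \<exists>h\<^sub>0>0. \<forall>h E \<psi>.
      0 < h \<and> h < h\<^sub>0 \<and> E \<in> {E\<^sub>0 - \<epsilon>\<^sub>0 / 2 <..< E\<^sub>0 + \<epsilon>\<^sub>0 / 2} \<and> E < E\<^sub>0 + \<epsilon> \<and>
      normalized_eigenfunction v h E \<psi> \<longrightarrow> potential_energy v \<psi> \<ge> c * E"
  \<comment> \<open>For \<open>c \<le> 0\<close> the claim is a matter of signs, since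
    \<open>E\<close> and the potential energy are nonnegative; the other case divides by
    \<open>c\<close>.\<close>
  proof (cases "c \<le> 0")
    case True
    have "potential_energy v \<psi> \<ge> c * E" if "0 < h" "normalized_eigenfunction v h E \<psi>" for h E \<psi>
    proof -
      interpret eigenfunction v h E \<psi> by unfold_locales (use assms that in auto)
      have "c * E \<le> 0" using True eigenvalue_nonneg by (rule mult_nonpos_nonneg)
      then show ?thesis using U0[of \<psi>] by linarith
    qed
    then show ?thesis using zero_less_one[where 'a = real] by blast
  next
    case False
    \<comment> \<open>Half of the slack \<open>2 / c - (c\<^sub>0 + 2)\<close>: one share pays for
      passing from \<open>c\<^sub>0\<close> to \<open>c\<^sub>0 + \<gamma>\<close> above the energy,
      the other absorbs the error of order \<open>h\<^sup>2\<close>.\<close>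
    define \<gamma> where "\<gamma> = (2 / c - c\<^sub>0 - 2) / 2"
    have \<gamma>: "0 < \<gamma>" "2 + c\<^sub>0 + 2 * \<gamma> = 2 / c"
      using c False assms(12) by (simp_all add: \<gamma>_def field_simps)
    \<comment> \<open>Disjointness of the wells makes the choice unique on their union; outside it
      the value is arbitrary.\<close>
    define q where "q x = p (SOME n. n \<in> {1..N} \<and> x \<in> W n)" for x
    have q_eq: "q x = p n" if "n \<in> {1..N}" "x \<in> W n" for n x
    proof -
      have "(SOME n. n \<in> {1..N} \<and> x \<in> W n) = n"
        using that assms(11) by (intro some_equality) blast+
      then show ?thesis by (simp add: q_def)
    qed
    have well: "\<exists>n\<in>{1..N}. x \<in> W n" if "v x < E\<^sub>0 + \<epsilon>\<^sub>0" for x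
      using assms(9) that by (auto simp: sublevel_def)
    have q_const: "\<exists>S. open S \<and> x \<in> S \<and> (\<forall>y\<in>S. q y = q x)" if "v x < E\<^sub>0 + \<epsilon>\<^sub>0" for x
    proof -
      obtain n where n: "n \<in> {1..N}" "x \<in> W n" using well[OF \<open>v x < E\<^sub>0 + \<epsilon>\<^sub>0\<close>] by blast
      then have "\<forall>y\<in>W n. q y = q x" using q_eq by metis
      then show ?thesis using n assms(10) by blast
    qed
    have q_le: "(x - q x) \<bullet> grad v x \<le> c\<^sub>0 * v x" if x: "v x < E\<^sub>0" for x
    proof -
      obtain n where n: "n \<in> {1..N}" "x \<in> W n" using well[of x] x assms(8) by auto
      then have "x \<in> sublevel v E\<^sub>0 \<inter> W n" using x by (simp add: sublevel_def)
      then show ?thesis using assms(14) n q_eq[OF n] by simp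
    qed
    have v0: "0 \<le> v x" for x using assms(2) by blast
    obtain \<delta> where \<delta>: "\<delta> > 0" "4 * \<delta> \<le> \<epsilon>\<^sub>0" "compact {x. v x \<le> E\<^sub>0 + 4 * \<delta>}"
        "\<And>x. v x < E\<^sub>0 + 4 * \<delta> \<Longrightarrow> (x - q x) \<bullet> grad v x \<le> (c\<^sub>0 + \<gamma>) * v x"
      using virial_condition_extends[OF assms(1) v0 assms(7,6,5,8) \<gamma>(1) q_const q_le] by auto
    have q_const': "\<exists>S. open S \<and> x \<in> S \<and> (\<forall>y\<in>S. q y = q x)" if "v x < E\<^sub>0 + 4 * \<delta>" for x
      by (rule q_const) (use that \<delta>(2) in linarith)
    have "0 \<le> c\<^sub>0 + \<gamma>" using assms(12) \<gamma>(1) by simp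
    then obtain F F' X Z g' \<eta> \<eta>' K B \<kappa> M where
      mult: "virial_multiplier v (E\<^sub>0 + \<delta>) (c\<^sub>0 + \<gamma>) F F' X Z g' \<eta> \<eta>' K B \<kappa> M"
      using exists_virial_multiplier[OF assms(1) v0 \<delta>(1) assms(5) _ \<delta>(3) q_const' \<delta>(4)] by auto
    define C where
      "C = B * (2 * real DIM(real ^ 'd) * \<kappa> + 3 / 2 * (real DIM(real ^ 'd) * M + \<kappa>)) / (E\<^sub>0 + \<delta>)"
    \<comment> \<open>Chosen so that \<open>h\<^sup>2 * C \<le> \<gamma>\<close> for
      \<open>h < h\<^sub>0\<close>; the summand 1 keeps the denominator positive. The multiplier,
      and with it \<open>C\<close>, was fixed before \<open>h\<close>, \<open>E\<close> and \<psi>,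
      so \<open>h\<^sub>0\<close> is uniform in them.\<close>
    define h\<^sub>0 where "h\<^sub>0 = sqrt (\<gamma> / (\<bar>C\<bar> + 1))"
    have h\<^sub>0: "0 < h\<^sub>0" using \<gamma>(1) by (simp add: h\<^sub>0_def)
    have "potential_energy v \<psi> \<ge> c * E"
      if h: "0 < h" "h < h\<^sub>0" and E: "E < E\<^sub>0 + \<delta>" and \<psi>: "normalized_eigenfunction v h E \<psi>" for h E \<psi>
    proof -
      interpret virial_multiplier v "E\<^sub>0 + \<delta>" "c\<^sub>0 + \<gamma>" F F' X Z g' \<eta> \<eta>' K B \<kappa> M by (rule mult)
      interpret eigenfunction_virial v h E \<psi> "E\<^sub>0 + \<delta>" "c\<^sub>0 + \<gamma>" F F' X Z g' \<eta> \<eta>' K B \<kappa> M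
        by unfold_locales (use assms(1) v0 h E \<psi> in auto)
      have "h\<^sup>2 \<le> h\<^sub>0\<^sup>2" using h by (intro power_mono) auto
      then have "h\<^sup>2 \<le> \<gamma> / (\<bar>C\<bar> + 1)" using \<gamma>(1) by (simp add: h\<^sub>0_def)
      then have "h\<^sup>2 * (\<bar>C\<bar> + 1) \<le> \<gamma>" by (simp add: field_simps)
      moreover have "h\<^sup>2 * C \<le> h\<^sup>2 * (\<bar>C\<bar> + 1)" by (intro mult_left_mono) auto
      ultimately have "h\<^sup>2 * C \<le> \<gamma>" by linarith
      then have "(2 + (c\<^sub>0 + \<gamma>) + h\<^sup>2 * C) * U \<le> (2 + c\<^sub>0 + 2 * \<gamma>) * U"
        using U0[of \<psi>] by (intro mult_right_mono) auto
      moreover have "2 * E \<le> (2 + (c\<^sub>0 + \<gamma>) + h\<^sup>2 * C) * U"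
        unfolding C_def by (rule virial_bound)
      ultimately have "2 * E \<le> 2 / c * U" unfolding \<gamma>(2) by linarith
      then show ?thesis using False by (simp add: field_simps)
    qed
    \<comment> \<open>The energy window is \<open>\<epsilon> = \<delta>\<close>:
      \<open>E < E\<^sub>0 + \<delta>\<close> is what yields \<open>E_le\<close> for the level
      \<open>a = E\<^sub>0 + \<delta>\<close>.\<close>
    then show ?thesis using \<delta>(1) h\<^sub>0 by blast
  qed
qed

end
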